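(* Let $\rho$ be an odd prime with $\rho\equiv\pm5\pmod{12}$ and $\mathrm{ord}_\rho(3)=\rho-1$, let $m=\rho-1$, let $\alpha$ be a primitive element of $\mathrm{GF}(3^m)$, $\beta=\alpha^{(3^m-1)/(4\rho)}$, $\theta=\beta^{-1}$. Let $\mathcal{C}(\rho)=\{(\mathrm{Tr}_{3^m/3}(a\theta^i))_{i=0}^{2\rho-1}: a\in\mathrm{GF}(3^m)\}$, the ternary negacyclic code of length $2\rho$ with check polynomial the minimal polynomial of $\beta$ over $\mathrm{GF}(3)$. Let $h$ be any odd integer in $\{0,\dots,4\rho-1\}$ not in $\{3^j\bmod 4\rho:j\ge0\}\cup\{\rho,3\rho\}$, and let $$\overline{\mathcal{C}}(\rho)^\perp=\left\{\left(a(-1)^i+\mathrm{Tr}_{3^m/3^2}(b\beta^{2hi})\right)_{i=0}^{\rho-1}: a\in\mathrm{GF}(3^2),\ b\in\mathrm{GF}(3^m)\right\},$$ the dual of the $\mathrm{GF}(9)$-linear code $\{(\mathrm{Tr}_{3^m/3^2}(a\theta^{2i}))_{i=0}^{\rho-1}:a\in\mathrm{GF}(3^m)\}$. Then the dual code $\mathcal{C}(\rho)^\perp$ has parameters $[2\rho,\rho+1,d^\perp]$, where $d^\perp\ge d(\overline{\mathcal{C}}(\rho)^\perp)\ge\sqrt{\rho}$.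
   Context: A ternary negacyclic code of length $n$ is an ideal of $\mathrm{GF}(3)[x]/(x^n+1)$; its check polynomial is $(x^n+1)/g(x)$ with $g$ the monic generator polynomial. $\mathrm{Tr}_{3^m/3^k}$ denotes the trace from $\mathrm{GF}(3^m)$ to $\mathrm{GF}(3^k)$. $\perp$ denotes the Euclidean dual, $d(\cdot)$ the minimum Hamming distance, $[n,k,d]$ length, dimension, minimum distance. *)

theory Defs
  imports "HOL-Number_Theory.Number_Theory"
begin

(* Vectors of length n are functions nat => 'a that vanish outside {0..<n}. *)

definition hamming_weight :: "nat \<Rightarrow> (nat \<Rightarrow> 'a::zero) \<Rightarrow> nat" where
  "hamming_weight n c = card {i. i < n \<and> c i \<noteq> 0}"

(* minimum Hamming distance of a (linear) code = minimum weight of a nonzero codeword *)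
definition min_distance :: "nat \<Rightarrow> (nat \<Rightarrow> 'a::zero) set \<Rightarrow> nat" where
  "min_distance n S = Min (hamming_weight n ` {c \<in> S. \<exists>i<n. c i \<noteq> 0})"

definition rel_trace :: "nat \<Rightarrow> nat \<Rightarrow> 'a::field \<Rightarrow> 'a" where
  "rel_trace q d x = (\<Sum>j<d. x ^ (q ^ j))"

definition primitive_element :: "'a::field \<Rightarrow> bool" where
  "primitive_element \<alpha> \<longleftrightarrow> \<alpha> \<noteq> 0 \<and> (\<forall>x. x \<noteq> 0 \<longrightarrow> (\<exists>k::nat. x = \<alpha> ^ k))"

(* subfield GF(q) of a finite field of characteristic p, q a power of p *)
definition subfield_GF :: "nat \<Rightarrow> 'a::field set" where
  "subfield_GF q = {x. x ^ q = x}"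

definition dual_code :: "'a::field set \<Rightarrow> nat \<Rightarrow> (nat \<Rightarrow> 'a) set \<Rightarrow> (nat \<Rightarrow> 'a) set" where
  "dual_code F n S = {v. (\<forall>i<n. v i \<in> F) \<and> (\<forall>i\<ge>n. v i = 0) \<and>
                          (\<forall>c\<in>S. (\<Sum>i<n. v i * c i) = 0)}"

definition code_C :: "nat \<Rightarrow> nat \<Rightarrow> 'a::field \<Rightarrow> (nat \<Rightarrow> 'a) set" where
  "code_C m \<rho> \<theta> = {(\<lambda>i. if i < 2*\<rho> then rel_trace 3 m (a * \<theta> ^ i) else 0) | a. True}"

definition code_Cbar_dual :: "nat \<Rightarrow> nat \<Rightarrow> nat \<Rightarrow> 'a::field \<Rightarrow> (nat \<Rightarrow> 'a) set" where
  "code_Cbar_dual m \<rho> h \<beta> = {(\<lambda>i. if i < \<rho> then a * (-1) ^ i + rel_trace 9 (m div 2) (b * \<beta> ^ (2*h*i)) else 0)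
                              | a b. a \<in> subfield_GF 9}"

end

theory Submission
  imports Defs "HOL-Computational_Algebra.Polynomial"
begin

text \<open>
  Put \<open>\<zeta> = -\<beta>\<^sup>2\<close>, a primitive \<open>\<rho>\<close>-th root of unity. After multiplying the \<open>i\<close>-th coordinate by \<open>(-1)\<^sup>i\<close>,
  the words of the second code are functions on the integers mod \<open>\<rho>\<close> whose Fourier
  transform vanishes on one of the two classes of nonzero squares and nonsquares: it is a quadratic
  residue code. If such a word \<open>f\<close> has nonzero sum, then the convolution of \<open>f\<close> with \<open>x \<mapsto> f (n x)\<close>,
  \<open>n\<close> a nonsquare, is a nonzero constant, so \<open>\<rho>\<close> is at most the square of the weight.
  A word of sum zero is an eigenvector of convolution with the quadratic character \<open>\<chi>\<close>; shifted to be
  nonzero at \<open>0\<close>, it is mapped by \<open>g x = \<chi> x f (-1/x)\<close> to a word of the code with nonzero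
  sum and smaller weight.

  A ternary word of length \<open>2\<rho>\<close> lies in the dual of the first code iff it vanishes at
  \<open>\<theta>\<close> as a polynomial. Its dimension follows because \<open>\<theta>\<close> has \<open>\<rho> - 1\<close> distinct conjugates. Such a word
  folds into a word of length \<open>\<rho>\<close> over GF(9) of no larger weight that vanishes at \<open>\<theta>\<^sup>2\<close>.
  This word or its cube, depending on whether \<open>h\<close> is a nonsquare or a square mod \<open>\<rho>\<close>, is in the
  second code by Fourier inversion.
\<close>

section \<open>The Legendre symbol\<close>

lemma Legendre_mod: "Legendre (a mod p) p = Legendre a p"
  unfolding Legendre_def QuadRes_def by (simp add: cong_def)

lemma Legendre_cong: "[a = b] (mod p) \<Longrightarrow> Legendre a p = Legendre b p"
  by (metis Legendre_mod cong_def)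

lemma Legendre_eq_0_iff: "Legendre a p = 0 \<longleftrightarrow> p dvd a"
  unfolding Legendre_def by (auto simp: cong_0_iff)

lemma Legendre_cases: "Legendre a p = 0 \<or> Legendre a p = 1 \<or> Legendre a p = -1"
  unfolding Legendre_def by auto

lemma Legendre_1: "prime p \<Longrightarrow> Legendre 1 (int p) = 1"
proof -
  assume "prime p"
  hence "\<not> [1 = 0] (mod int p)"
    by (auto simp: cong_0_iff)
  moreover have "QuadRes (int p) 1"
    unfolding QuadRes_def by (intro exI[of _ 1]) simp
  ultimately show ?thesis
    unfolding Legendre_def by simp
qed

text \<open>Euler's criterion gives the identity modulo \<open>p\<close>. Both sides lie in {-1, 0,
  1}, so they differ by at most 2, which is less than \<open>p\<close>.\<close>

lemma Legendre_mult:
  assumes "prime p" "p > 2"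
  shows "Legendre (a * b) (int p) = Legendre a (int p) * Legendre b (int p)"
proof -
  have "[Legendre (a * b) (int p) = Legendre a (int p) * Legendre b (int p)] (mod int p)"
    using cong_mult[OF euler_criterion[OF assms, of a] euler_criterion[OF assms, of b]]
          euler_criterion[OF assms, of "a * b"]
    by (metis cong_sym cong_trans power_mult_distrib)
  hence dvd: "int p dvd Legendre (a * b) (int p) - Legendre a (int p) * Legendre b (int p)"
    by (simp add: cong_iff_dvd_diff)
  have "\<bar>Legendre (a * b) (int p) - Legendre a (int p) * Legendre b (int p)\<bar> \<le> 2"
    using Legendre_cases[of "a * b" "int p"] Legendre_cases[of a "int p"] Legendre_cases[of b "int p"]
    by auto
  with dvd assms show ?thesis
    using zdvd_imp_le[of "int p" "\<bar>Legendre (a * b) (int p) - Legendre a (int p) * Legendre b (int p)\<bar>"]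
    by force
qed

lemma Legendre_power:
  assumes "prime p" "p > 2"
  shows "Legendre (a ^ k) (int p) = Legendre a (int p) ^ k"
  by (induction k) (use assms in \<open>auto simp: Legendre_mult Legendre_1\<close>)

text \<open>Were the symbol 1, Euler's criterion would give \<open>g\<close> an order of at most
  \<open>(p - 1) div 2\<close>.\<close>

lemma Legendre_primitive_root:
  assumes "prime p" "p > 2" and ord: "ord p g = p - 1"
  shows "Legendre (int g) (int p) = -1"
proof -
  \<comment> \<open>By convention \<open>ord\<close> is 0 on arguments that are not coprime, while
    \<open>p - 1\<close> is positive.\<close>
  have "coprime p g"
    using ord_eq_0[of p g] ord assms(2) by auto
  hence "\<not> p dvd g"
    using assms by (metis coprime_common_divisor dvd_refl not_prime_unit)
  hence "Legendre (int g) (int p) \<noteq> 0"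
    by (simp add: Legendre_eq_0_iff)
  moreover have "Legendre (int g) (int p) \<noteq> 1"
  proof
    assume "Legendre (int g) (int p) = 1"
    hence "[int g ^ ((p - 1) div 2) = 1] (mod int p)"
      using euler_criterion[OF assms(1,2), of "int g"] by (simp add: cong_sym_eq)
    hence "[g ^ ((p - 1) div 2) = 1] (mod p)"
      by (simp flip: cong_int_iff)
    moreover have "0 < (p - 1) div 2" "(p - 1) div 2 < ord p g"
      using assms by auto
    ultimately show False
      using ord_minimal by blast
  qed
  ultimately show ?thesis
    using Legendre_cases by metis
qed

lemma exists_Legendre_eq_minus_1:
  assumes "prime p" "p > 2"
  obtains n where "Legendre n (int p) = -1"
  using residue_prime_has_primroot[OF assms(1)] Legendre_primitive_root[OF assms]
  by metis

section \<open>The square root bound for quadratic residue codes\<close>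

text \<open>As \<open>p\<close> is prime, \<open>\<zeta> \<noteq> 1\<close> makes
  \<open>\<zeta>\<close> a primitive \<open>p\<close>-th root of unity. Fourier inversion divides by
  \<open>p\<close>; sign arguments with the quadratic character divide by 2.\<close>

locale prime_root_of_unity =
  fixes p :: nat and \<zeta> :: "'a::field"
  assumes prime_p: "prime p" and p_gt_2: "p > 2"
    and root: "\<zeta> ^ p = 1" and root_neq_1: "\<zeta> \<noteq> 1"
    and of_nat_p_neq_0: "of_nat p \<noteq> (0 :: 'a)" and two_neq_0: "(2 :: 'a) \<noteq> 0"
begin

section \<open>Fourier analysis modulo \<open>p\<close>\<close>

abbreviation Zp :: "int set" where "Zp \<equiv> {0..<int p}"

text \<open>Functions on the integers mod \<open>p\<close> are encoded as periodic functions on all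
  of \<open>int\<close>, so that arguments such as \<open>t - x\<close> or \<open>n * x\<close> need
  no reduction; sums run over the representatives \<open>Zp\<close>.\<close>

definition periodic :: "(int \<Rightarrow> 'a) \<Rightarrow> bool" where
  "periodic f \<longleftrightarrow> (\<forall>x y. [x = y] (mod int p) \<longrightarrow> f x = f y)"

definition dft :: "(int \<Rightarrow> 'a) \<Rightarrow> int \<Rightarrow> 'a" where
  "dft f r = (\<Sum>x\<in>Zp. f x * \<zeta> powi (r * x))"

definition conv :: "(int \<Rightarrow> 'a) \<Rightarrow> (int \<Rightarrow> 'a) \<Rightarrow> int \<Rightarrow> 'a" where
  "conv f g t = (\<Sum>x\<in>Zp. f (t - x) * g x)"

definition \<chi> :: "int \<Rightarrow> 'a" where
  "\<chi> x = of_int (Legendre x (int p))"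

definition weight :: "(int \<Rightarrow> 'a) \<Rightarrow> nat" where
  "weight f = card {x \<in> Zp. f x \<noteq> 0}"

lemma periodicD: "periodic f \<Longrightarrow> [x = y] (mod int p) \<Longrightarrow> f x = f y"
  unfolding periodic_def by blast

lemma finite_support: "finite {x \<in> Zp. f x \<noteq> (0 :: 'a)}"
  by (rule finite_subset[of _ Zp]) auto

lemma p_pos: "int p > 0"
  using p_gt_2 by simp

lemma prime_int_p: "prime (int p)"
  using prime_p by simp

lemma root_neq_0: "\<zeta> \<noteq> 0"
  using root p_gt_2 by (auto simp: power_0_left)

lemma root_powi_cong:
  assumes "[x = y] (mod int p)" shows "\<zeta> powi x = \<zeta> powi y"
proof -
  from assms obtain k where k: "x = y + int p * k"
    by (metis cong_iff_lin cong_sym_eq mult.commute)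
  show ?thesis
    unfolding k by (subst power_int_add) (auto simp: root_neq_0 power_int_mult root)
qed

text \<open>If \<open>x\<close> has an inverse \<open>y\<close> modulo \<open>p\<close>, then
  \<open>\<zeta> powi x = 1\<close> would force
  \<open>\<zeta> = \<zeta> powi (x * y) = 1\<close>.\<close>

lemma root_powi_eq_1_iff: "\<zeta> powi x = 1 \<longleftrightarrow> int p dvd x"
proof
  assume "int p dvd x"
  thus "\<zeta> powi x = 1"
    using root_powi_cong[of x 0] by (simp add: cong_0_iff)
next
  assume eq: "\<zeta> powi x = 1"
  show "int p dvd x"
  proof (rule ccontr)
    assume "\<not> int p dvd x"
    hence "coprime x (int p)"
      using prime_int_p prime_imp_coprime coprime_commute by metis
    then obtain y where y: "[x * y = 1] (mod int p)"
      using cong_solve_coprime_int by blast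
    have "\<zeta> powi (x * y) = 1"
      by (simp add: power_int_mult eq)
    with root_powi_cong[OF y] root_neq_1 show False by simp
  qed
qed

text \<open>A map that is injective modulo \<open>p\<close> on the finite set \<open>Zp\<close>
  permutes the residues. Translations, reflections, scalings and later
  \<open>x \<mapsto> -1/x\<close> are instances.\<close>

lemma sum_reindex_mod:
  assumes f: "periodic f" and \<sigma>: "\<And>x y. x \<in> Zp \<Longrightarrow> y \<in> Zp \<Longrightarrow> [\<sigma> x = \<sigma> y] (mod int p) \<Longrightarrow> x = y"
  shows "(\<Sum>x\<in>Zp. f (\<sigma> x)) = (\<Sum>x\<in>Zp. f x)"
proof -
  let ?\<tau> = "\<lambda>x. \<sigma> x mod int p"
  have inj: "inj_on ?\<tau> Zp"
    by (rule inj_onI, rule \<sigma>) (auto simp: cong_def)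
  moreover have sub: "?\<tau> ` Zp \<subseteq> Zp"
    using p_pos by auto
  ultimately have "?\<tau> ` Zp = Zp"
    by (intro card_subset_eq) (auto simp: card_image)
  hence "(\<Sum>x\<in>Zp. f x) = (\<Sum>x\<in>Zp. f (?\<tau> x))"
    using inj by (metis (no_types, lifting) sum.reindex_cong)
  also have "\<dots> = (\<Sum>x\<in>Zp. f (\<sigma> x))"
    by (intro sum.cong refl periodicD[OF f]) (auto simp: cong_def)
  finally show ?thesis ..
qed

lemma Zp_cong_eq: "x \<in> Zp \<Longrightarrow> y \<in> Zp \<Longrightarrow> [x = y] (mod int p) \<Longrightarrow> x = y"
  by (auto simp: cong_def)

lemma sum_shift: "periodic f \<Longrightarrow> (\<Sum>x\<in>Zp. f (x + t)) = (\<Sum>x\<in>Zp. f x)"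
  by (rule sum_reindex_mod) (auto simp: cong_add_rcancel intro: Zp_cong_eq)

lemma sum_reflect: "periodic f \<Longrightarrow> (\<Sum>x\<in>Zp. f (t - x)) = (\<Sum>x\<in>Zp. f x)"
  by (rule sum_reindex_mod) (auto intro!: Zp_cong_eq simp: cong_iff_dvd_diff dvd_diff_commute)

lemma coprime_p_iff: "coprime n (int p) \<longleftrightarrow> \<not> int p dvd n"
  using prime_int_p by (metis coprime_commute coprime_common_divisor dvd_refl not_prime_unit prime_imp_coprime)

lemma sum_scale:
  assumes "periodic f" "\<not> int p dvd n" shows "(\<Sum>x\<in>Zp. f (n * x)) = (\<Sum>x\<in>Zp. f x)"
proof (rule sum_reindex_mod[OF assms(1)])
  fix x y assume xy: "x \<in> Zp" "y \<in> Zp" "[n * x = n * y] (mod int p)"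
  have "coprime n (int p)" using assms(2) coprime_p_iff by blast
  with xy show "x = y"
    using cong_mult_lcancel Zp_cong_eq by metis
qed

text \<open>Orthogonality of characters: shifting the index by 1 multiplies the sum by
  \<open>\<zeta> powi r\<close>, which differs from 1 unless \<open>p\<close> divides
  \<open>r\<close>.\<close>

lemma sum_root_powi: "(\<Sum>x\<in>Zp. \<zeta> powi (r * x)) = (if int p dvd r then of_nat p else 0)"
proof (cases "int p dvd r")
  case True
  hence "(\<Sum>x\<in>Zp. \<zeta> powi (r * x)) = (\<Sum>x\<in>Zp. 1)"
    by (intro sum.cong refl) (simp add: root_powi_eq_1_iff)
  with True show ?thesis by simp
next
  case False
  have per: "periodic (\<lambda>x. \<zeta> powi (r * x))"
    unfolding periodic_def by (auto intro!: root_powi_cong cong_scalar_left)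
  have "(\<Sum>x\<in>Zp. \<zeta> powi (r * x)) = (\<Sum>x\<in>Zp. \<zeta> powi (r * (x + 1)))"
    using sum_shift[OF per, of 1] by simp
  also have "\<dots> = \<zeta> powi r * (\<Sum>x\<in>Zp. \<zeta> powi (r * x))"
    by (simp add: sum_distrib_left algebra_simps power_int_add root_neq_0)
  finally have "(\<zeta> powi r - 1) * (\<Sum>x\<in>Zp. \<zeta> powi (r * x)) = 0"
    by (simp add: algebra_simps)
  with False show ?thesis by (simp add: root_powi_eq_1_iff)
qed

lemma dft_inversion:
  assumes "periodic f"
  shows "of_nat p * f x = (\<Sum>r\<in>Zp. dft f r * \<zeta> powi (- (r * x)))"
proof -
  have "(\<Sum>r\<in>Zp. dft f r * \<zeta> powi (- (r * x))) =
        (\<Sum>r\<in>Zp. \<Sum>y\<in>Zp. f y * \<zeta> powi ((y - x) * r))"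
    unfolding dft_def sum_distrib_right
  proof (intro sum.cong refl)
    fix r y
    have "\<zeta> powi ((y - x) * r) = \<zeta> powi (r * y) * \<zeta> powi (- (r * x))"
      by (subst power_int_add[symmetric]) (auto simp: root_neq_0 algebra_simps)
    thus "f y * \<zeta> powi (r * y) * \<zeta> powi (- (r * x)) = f y * \<zeta> powi ((y - x) * r)"
      by (simp add: mult.assoc)
  qed
  also have "\<dots> = (\<Sum>y\<in>Zp. f y * (\<Sum>r\<in>Zp. \<zeta> powi ((y - x) * r)))"
    by (subst sum.swap) (simp add: sum_distrib_left)
  \<comment> \<open>By orthogonality only the representative of \<open>x\<close> survives.\<close>
  also have "\<dots> = (\<Sum>y\<in>Zp. if y = x mod int p then f y * of_nat p else 0)"
  proof (intro sum.cong refl)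
    fix y assume y: "y \<in> Zp"
    have "int p dvd y - x \<longleftrightarrow> [y = x] (mod int p)"
      by (simp add: cong_iff_dvd_diff)
    also have "\<dots> \<longleftrightarrow> y = x mod int p"
      using y by (auto simp: cong_def)
    finally show "f y * (\<Sum>r\<in>Zp. \<zeta> powi ((y - x) * r)) = (if y = x mod int p then f y * of_nat p else 0)"
      by (simp add: sum_root_powi)
  qed
  also have "\<dots> = f (x mod int p) * of_nat p"
    using p_pos by simp
  also have "f (x mod int p) = f x"
    by (rule periodicD[OF assms]) (auto simp: cong_def)
  finally show ?thesis by (simp add: mult.commute)
qed

lemma dft_inject:
  assumes "periodic f" "periodic g" "\<And>r. dft f r = dft g r"
  shows "f x = g x"
proof -
  have "of_nat p * f x = of_nat p * g x"
    using assms by (simp add: dft_inversion)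
  thus ?thesis using of_nat_p_neq_0 by simp
qed

lemma periodic_conv: "periodic f \<Longrightarrow> periodic (conv f g)"
  unfolding periodic_def[of "conv f g"] conv_def
  by (intro allI impI sum.cong refl arg_cong2[of _ _ _ _ "(*)"]) (auto elim!: periodicD intro: cong_diff)

lemma dft_conv:
  assumes "periodic f"
  shows "dft (conv f g) r = dft f r * dft g r"
proof -
  have "dft (conv f g) r = (\<Sum>t\<in>Zp. \<Sum>x\<in>Zp. f (t - x) * g x * \<zeta> powi (r * t))"
    unfolding dft_def conv_def by (simp add: sum_distrib_right)
  also have "\<dots> = (\<Sum>x\<in>Zp. \<Sum>t\<in>Zp. g x * \<zeta> powi (r * x) * (f (t - x) * \<zeta> powi (r * (t - x))))"
    by (subst sum.swap, intro sum.cong refl)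
       (simp add: power_int_diff right_diff_distrib root_neq_0)
  also have "\<dots> = (\<Sum>x\<in>Zp. g x * \<zeta> powi (r * x) * dft f r)"
  proof (intro sum.cong refl)
    fix x
    have "periodic (\<lambda>t. f t * \<zeta> powi (r * t))"
      unfolding periodic_def
      by (intro allI impI arg_cong2[of _ _ _ _ "(*)"] root_powi_cong cong_scalar_left periodicD[OF assms])
    from sum_shift[OF this, of "-x"]
    show "(\<Sum>t\<in>Zp. g x * \<zeta> powi (r * x) * (f (t - x) * \<zeta> powi (r * (t - x)))) =
          g x * \<zeta> powi (r * x) * dft f r"
      unfolding dft_def by (simp flip: sum_distrib_left)
  qed
  also have "\<dots> = dft f r * dft g r"
    unfolding dft_def[of g] by (simp add: sum_distrib_left mult_ac)
  finally show ?thesis .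
qed

section \<open>The quadratic character and its Gauss sum\<close>

lemma \<chi>_cong: "[x = y] (mod int p) \<Longrightarrow> \<chi> x = \<chi> y"
  unfolding \<chi>_def using Legendre_cong by metis

lemma periodic_\<chi>: "periodic \<chi>"
  unfolding periodic_def using \<chi>_cong by blast

lemma \<chi>_mult: "\<chi> (x * y) = \<chi> x * \<chi> y"
  unfolding \<chi>_def using prime_p p_gt_2 by (simp add: Legendre_mult)

lemma \<chi>_1: "\<chi> 1 = 1"
  unfolding \<chi>_def using prime_p by (simp add: Legendre_1)

lemma \<chi>_eq_0_iff: "\<chi> x = 0 \<longleftrightarrow> int p dvd x"
  using Legendre_cases[of x "int p"] Legendre_eq_0_iff[of x "int p"] unfolding \<chi>_def by auto

lemma \<chi>_square: "\<not> int p dvd x \<Longrightarrow> \<chi> x * \<chi> x = 1"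
  using Legendre_cases[of x "int p"] Legendre_eq_0_iff[of x "int p"] unfolding \<chi>_def by auto

text \<open>Here \<open>dft \<chi> 1\<close> is the quadratic Gauss sum. For \<open>r\<close> prime
  to \<open>p\<close>, substitute \<open>r * x\<close> for \<open>x\<close>. Otherwise the transform
  is the plain sum of \<open>\<chi>\<close>, which scaling by a nonsquare both preserves and
  negates.\<close>

lemma dft_\<chi>: "dft \<chi> r = \<chi> r * dft \<chi> 1"
proof (cases "int p dvd r")
  case False
  have "periodic (\<lambda>x. \<chi> x * \<zeta> powi (1 * x))"
    unfolding periodic_def
    by (intro allI impI arg_cong2[of _ _ _ _ "(*)"] root_powi_cong cong_scalar_left \<chi>_cong)
  from sum_scale[OF this False]
  have "dft \<chi> 1 = (\<Sum>x\<in>Zp. \<chi> r * (\<chi> x * \<zeta> powi (r * x)))"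
    unfolding dft_def by (simp add: \<chi>_mult mult_ac)
  hence "dft \<chi> 1 = \<chi> r * dft \<chi> r"
    unfolding dft_def by (simp add: sum_distrib_left)
  thus ?thesis
    using \<chi>_square[OF False] by (metis mult.assoc mult_1)
next
  case True
  obtain n where n: "Legendre n (int p) = -1"
    using exists_Legendre_eq_minus_1 prime_p p_gt_2 by blast
  hence "\<not> int p dvd n"
    using Legendre_eq_0_iff[of n "int p"] by auto
  from sum_scale[OF periodic_\<chi> this]
  have "\<chi> n * (\<Sum>x\<in>Zp. \<chi> x) = (\<Sum>x\<in>Zp. \<chi> x)"
    by (simp add: \<chi>_mult sum_distrib_left)
  hence "2 * (\<Sum>x\<in>Zp. \<chi> x) = 0"
    by (simp add: n \<chi>_def[of n])
  hence "(\<Sum>x\<in>Zp. \<chi> x) = 0"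
    using two_neq_0 by simp
  moreover have "\<zeta> powi (r * x) = 1" for x
    using True by (simp add: root_powi_eq_1_iff)
  ultimately have "dft \<chi> r = 0"
    unfolding dft_def by simp
  thus ?thesis using True \<chi>_eq_0_iff by simp
qed

text \<open>A vanishing Gauss sum would make the whole transform of \<open>\<chi>\<close> vanish,
  against inversion at 1.\<close>

lemma dft_\<chi>_1_neq_0: "dft \<chi> 1 \<noteq> 0"
proof
  assume "dft \<chi> 1 = 0"
  hence "dft \<chi> r = 0" for r
    by (metis dft_\<chi> mult_zero_right)
  with dft_inversion[OF periodic_\<chi>, of 1] show False
    using of_nat_p_neq_0 by (simp add: \<chi>_1)
qed

lemma dft_at_0: "dft f 0 = (\<Sum>x\<in>Zp. f x)"
  unfolding dft_def by simp

section \<open>The bound for words with nonzero sum\<close>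

lemma dft_scale:
  assumes "periodic f" "[n * n' = 1] (mod int p)"
  shows "dft (\<lambda>x. f (n * x)) r = dft f (r * n')"
proof -
  have n: "\<not> int p dvd n"
    using assms(2) by (metis cong_dvd_iff cong_sym dvd_mult2 not_prime_unit prime_int_p)
  have per: "periodic (\<lambda>x. f x * \<zeta> powi (r * n' * x))"
    unfolding periodic_def
    by (intro allI impI arg_cong2[of _ _ _ _ "(*)"] root_powi_cong cong_scalar_left periodicD[OF assms(1)])
  have "dft f (r * n') = (\<Sum>x\<in>Zp. f (n * x) * \<zeta> powi (r * n' * (n * x)))"
    unfolding dft_def using sum_scale[OF per n] by simp
  also have "\<dots> = dft (\<lambda>x. f (n * x)) r"
    unfolding dft_def
  proof (intro sum.cong refl arg_cong2[of _ _ _ _ "(*)"] root_powi_cong)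
    fix x
    have "[r * x * (n * n') = r * x * 1] (mod int p)"
      using assms(2) by (intro cong_scalar_left)
    thus "[r * n' * (n * x) = r * x] (mod int p)"
      by (simp add: mult_ac)
  qed
  finally show ?thesis ..
qed

text \<open>At each nonzero frequency \<open>f\<close> or its scaling by a nonsquare has transform
  0, so their convolution is constant. Being nonzero, it forces every residue to be a combination of
  two support points of \<open>f\<close>.\<close>

lemma square_root_bound_odd_like:
  assumes f: "periodic f" and \<epsilon>: "\<epsilon> = 1 \<or> \<epsilon> = -1"
    and zeros: "\<And>r. Legendre r (int p) = \<epsilon> \<Longrightarrow> dft f r = 0"
    and "dft f 0 \<noteq> 0"
  shows "p \<le> (weight f)\<^sup>2"
proof -
  obtain n where n: "Legendre n (int p) = -1"
    using exists_Legendre_eq_minus_1 prime_p p_gt_2 by blast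
  hence ndvd: "\<not> int p dvd n"
    using Legendre_eq_0_iff[of n "int p"] by auto
  then obtain n' where n': "[n * n' = 1] (mod int p)"
    using cong_solve_coprime_int coprime_p_iff by blast
  have "Legendre (n * n') (int p) = 1"
    using Legendre_cong[OF n'] Legendre_1 prime_p by simp
  hence Ln': "Legendre n' (int p) = -1"
    using n prime_p p_gt_2 by (simp add: Legendre_mult)
  define g where "g = (\<lambda>x. f (n * x))"
  \<comment> \<open>The constant function whose transform at 0 is the square of
    \<open>dft f 0\<close>.\<close>
  define c where "c = dft f 0 * dft f 0 / of_nat p"
  have dft_g: "dft g r = dft f (r * n')" for r
    unfolding g_def by (rule dft_scale[OF f n'])
  have "conv f g t = c" for t
  proof (rule dft_inject[of "conv f g" "\<lambda>_. c"])
    show "periodic (conv f g)" by (rule periodic_conv[OF f])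
    show "periodic (\<lambda>_. c)" by (simp add: periodic_def)
    fix r
    have rhs: "dft (\<lambda>_. c) r = (if int p dvd r then c * of_nat p else 0)"
      unfolding dft_def by (simp add: sum_root_powi flip: sum_distrib_left)
    have dvd: "dft f r' = dft f 0" if "int p dvd r'" for r'
    proof -
      have "\<zeta> powi (r' * x) = 1" for x
        using that by (simp add: root_powi_eq_1_iff)
      thus ?thesis unfolding dft_def by simp
    qed
    show "dft (conv f g) r = dft (\<lambda>_. c) r"
    proof (cases "int p dvd r")
      case True
      thus ?thesis
        using of_nat_p_neq_0
        unfolding rhs by (simp add: dft_conv[OF f] dft_g dvd[of r] dvd[of "r * n'"] c_def)
    next
      case False
      \<comment> \<open>Since \<open>n'\<close> is a nonsquare, \<open>r\<close> and
        \<open>r * n'\<close> lie in opposite classes.\<close>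
      hence "Legendre r (int p) = \<epsilon> \<or> Legendre (r * n') (int p) = \<epsilon>"
        using Legendre_cases[of r "int p"] Legendre_eq_0_iff[of r "int p"] \<epsilon> Ln' prime_p p_gt_2
        by (auto simp: Legendre_mult)
      hence "dft f r = 0 \<or> dft g r = 0"
        using zeros dft_g by metis
      with False show ?thesis
        by (auto simp: rhs dft_conv[OF f])
    qed
  qed
  moreover have "c \<noteq> 0"
    using assms(4) of_nat_p_neq_0 unfolding c_def by simp
  ultimately have conv_neq_0: "conv f g t \<noteq> 0" for t by simp
  define S where "S = {x \<in> Zp. f x \<noteq> 0}"
  have fin: "finite S" unfolding S_def by (rule finite_support)
  \<comment> \<open>A nonzero term of the convolution at \<open>t\<close> puts \<open>t - x\<close>
    and \<open>n * x\<close> in the support modulo \<open>p\<close>, and \<open>t\<close> is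
    recovered as \<open>(t - x) + n' * (n * x)\<close>.\<close>
  have "Zp \<subseteq> (\<lambda>(x, y). (x + n' * y) mod int p) ` (S \<times> S)"
  proof
    fix t assume t: "t \<in> Zp"
    obtain x where x: "x \<in> Zp" "f (t - x) * g x \<noteq> 0"
      using conv_neq_0[of t] unfolding conv_def by (meson sum.not_neutral_contains_not_neutral)
    define y where "y = (n * x) mod int p"
    define z where "z = (t - x) mod int p"
    have "f y = g x"
      unfolding y_def g_def by (rule periodicD[OF f]) (simp add: cong_def)
    moreover have "f z = f (t - x)"
      unfolding z_def by (rule periodicD[OF f]) (simp add: cong_def)
    ultimately have mem: "z \<in> S" "y \<in> S"
      using x(2) p_pos unfolding S_def y_def z_def by auto
    have "[z + n' * y = (t - x) + n' * (n * x)] (mod int p)"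
      unfolding y_def z_def by (intro cong_add cong_scalar_left) (auto simp: cong_def)
    also have "(t - x) + n' * (n * x) = (t - x) + x * (n * n')"
      by (simp add: mult_ac)
    also have "[(t - x) + x * (n * n') = (t - x) + x * 1] (mod int p)"
      by (intro cong_add cong_scalar_left n' cong_refl)
    finally have "[z + n' * y = t] (mod int p)" by simp
    hence "(z + n' * y) mod int p = t"
      using t by (simp add: cong_def)
    thus "t \<in> (\<lambda>(x, y). (x + n' * y) mod int p) ` (S \<times> S)"
      using mem by force
  qed
  hence "card Zp \<le> card (S \<times> S)"
    using fin by (meson card_image_le card_mono finite_SigmaI finite_imageI le_trans)
  thus ?thesis
    unfolding weight_def S_def[symmetric] by (simp add: card_cartesian_product power2_eq_square)
qed

section \<open>The substitution \<open>x \<mapsto> -1/x\<close> and words of sum zero\<close>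

definition mod_inv :: "int \<Rightarrow> int" where
  "mod_inv x = x ^ (p - 2)"

lemma mod_inv_cong: "[x = y] (mod int p) \<Longrightarrow> [mod_inv x = mod_inv y] (mod int p)"
  unfolding mod_inv_def by (rule cong_pow)

lemma mod_inv:
  assumes "\<not> int p dvd x" shows "[x * mod_inv x = 1] (mod int p)"
proof -
  have "[x ^ (p - 1) = 1] (mod int p)"
  proof -
    define y where "y = nat (x mod int p)"
    have y: "int y = x mod int p"
      unfolding y_def using p_pos by simp
    have "\<not> p dvd y"
      using assms y by (metis dvd_mod_iff dvd_refl int_dvd_int_iff)
    hence "[int y ^ (p - 1) = 1] (mod int p)"
      using fermat_theorem[OF prime_p] by (simp flip: cong_int_iff)
    thus ?thesis
      unfolding y by (simp add: cong_def power_mod)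
  qed
  moreover have "p - 1 = Suc (p - 2)"
    using p_gt_2 by simp
  ultimately show ?thesis
    unfolding mod_inv_def by simp
qed

lemma dvd_mod_inv_iff: "int p dvd mod_inv x \<longleftrightarrow> int p dvd x"
  unfolding mod_inv_def using p_gt_2 prime_int_p by (auto simp: prime_dvd_power_iff)

text \<open>As \<open>p - 2\<close> is positive, \<open>mod_inv\<close> sends multiples of
  \<open>p\<close> to multiples of \<open>p\<close>. So \<open>-1/x\<close>, with 0 fixed, is an
  involution on all residues.\<close>

lemma neg_mod_inv_involution: "[- mod_inv (- mod_inv x) = x] (mod int p)"
proof (cases "int p dvd x")
  case True
  hence "int p dvd - mod_inv (- mod_inv x)"
    using dvd_mod_inv_iff by simp
  with True show ?thesis
    by (simp add: cong_iff_dvd_diff)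
next
  case False
  define y where "y = - mod_inv x"
  have y: "\<not> int p dvd y"
    using False dvd_mod_inv_iff y_def by simp
  have "[- mod_inv y = - mod_inv y * (x * mod_inv x)] (mod int p)"
    using cong_scalar_left[OF cong_sym[OF mod_inv[OF False]], of "- mod_inv y"] by simp
  also have "- mod_inv y * (x * mod_inv x) = x * (y * mod_inv y)"
    by (simp add: y_def)
  also have "[\<dots> = x * 1] (mod int p)"
    by (intro cong_scalar_left mod_inv y)
  finally show ?thesis by (simp add: y_def)
qed

lemma inj_neg_mod_inv:
  assumes "x \<in> Zp" "y \<in> Zp" "[- mod_inv x = - mod_inv y] (mod int p)" shows "x = y"
proof (rule Zp_cong_eq[OF assms(1,2)])
  have "[- mod_inv (- mod_inv x) = - mod_inv (- mod_inv y)] (mod int p)"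
    using mod_inv_cong[OF assms(3)] by (simp add: cong_minus_minus_iff)
  thus "[x = y] (mod int p)"
    using neg_mod_inv_involution cong_trans cong_sym by metis
qed

text \<open>
  This is the Gleason--Prange substitution \<open>x \<mapsto> -1/x\<close>, twisted by the quadratic character.
  It maps an eigenvector of convolution with the character, of sum zero and nonzero at the origin, to
  a solution of the same equation with a nonzero inhomogeneity, which corresponds to the
  coordinate at infinity of the extended code.
\<close>

lemma gleason_prange:
  assumes f: "periodic f" and eigen: "\<And>x. conv \<chi> f x = l * f x" and sum0: "dft f 0 = 0"
  defines "g \<equiv> \<lambda>x. \<chi> x * f (- mod_inv x)"
  shows "conv \<chi> g x = l * g x - \<chi> (-1) * f 0"
proof -
  have per_g: "periodic (\<lambda>y. \<chi> (x - y) * g y)"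
    unfolding periodic_def g_def
    by (intro allI impI arg_cong2[of _ _ _ _ "(*)"] \<chi>_cong periodicD[OF f] mod_inv_cong
          cong_diff cong_refl) (auto simp: cong_minus_minus_iff intro: mod_inv_cong)
  \<comment> \<open>The summation variable \<open>y\<close> is replaced by \<open>-1/z\<close>,
    which turns the values of \<open>g\<close> back into values of \<open>f\<close>.\<close>
  have "conv \<chi> g x = (\<Sum>z\<in>Zp. \<chi> (x + mod_inv z) * g (- mod_inv z))"
    unfolding conv_def using sum_reindex_mod[OF per_g, of "\<lambda>z. - mod_inv z", OF inj_neg_mod_inv]
    by simp
  also have "\<dots> = (\<Sum>z\<in>Zp. \<chi> (x + mod_inv z) * \<chi> (- mod_inv z) * f z)"
    unfolding g_def using periodicD[OF f neg_mod_inv_involution] by (simp add: mult_ac)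
  finally have conv_g: "conv \<chi> g x = \<dots>" .
  have \<chi>_inv: "\<chi> (mod_inv z) = \<chi> z" if z: "\<not> int p dvd z" for z
  proof -
    have "\<chi> z * \<chi> (mod_inv z) = 1"
      using \<chi>_cong[OF mod_inv[OF z]] by (simp add: \<chi>_mult \<chi>_1)
    thus ?thesis using \<chi>_square[OF z] by (metis mult.assoc mult.commute mult_1)
  qed
  \<comment> \<open>In both cases below the term of \<open>z = 0\<close>, where
    \<open>\<chi> (- mod_inv z)\<close> vanishes, must be removed by hand; this is the source of the
    inhomogeneity.\<close>
  have delta: "(\<Sum>z\<in>Zp. (if int p dvd z then c * f z else 0)) = c * f 0" for c
  proof -
    have "(\<Sum>z\<in>Zp. (if int p dvd z then c * f z else 0)) = (\<Sum>z\<in>Zp. (if z = 0 then c * f z else 0))"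
      by (intro sum.cong refl) (use zdvd_not_zless in fastforce)
    thus ?thesis using p_pos by simp
  qed
  show ?thesis
  proof (cases "int p dvd x")
    case True
    \<comment> \<open>For \<open>x\<close> divisible by \<open>p\<close> and \<open>z\<close> not,
      the two character values multiply to \<open>\<chi> (-1)\<close>, so what remains is a multiple
      of the sum of \<open>f\<close>, which is zero.\<close>
    have "conv \<chi> g x = (\<Sum>z\<in>Zp. \<chi> (-1) * f z - (if int p dvd z then \<chi> (-1) * f z else 0))"
      unfolding conv_g
    proof (intro sum.cong refl)
      fix z
      have "[x + mod_inv z = 0 + mod_inv z] (mod int p)"
        using True by (intro cong_add) (auto simp: cong_0_iff)
      hence eq: "\<chi> (x + mod_inv z) = \<chi> (mod_inv z)"
        using \<chi>_cong by simp
      have "\<chi> (- mod_inv z) = \<chi> (-1) * \<chi> (mod_inv z)"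
        using \<chi>_mult[of "-1" "mod_inv z"] by simp
      thus "\<chi> (x + mod_inv z) * \<chi> (- mod_inv z) * f z =
            \<chi> (-1) * f z - (if int p dvd z then \<chi> (-1) * f z else 0)"
        using \<chi>_eq_0_iff[of "mod_inv z"] \<chi>_inv[of z] \<chi>_square[of z]
        by (auto simp: eq dvd_mod_inv_iff)
    qed
    also have "\<dots> = \<chi> (-1) * dft f 0 - \<chi> (-1) * f 0"
      unfolding sum_subtractf delta by (simp add: dft_at_0 sum_distrib_left)
    finally show ?thesis
      using True \<chi>_eq_0_iff[of x] sum0 unfolding g_def by simp
  next
    case False
    define x' where "x' = - mod_inv x"
    have xx': "[x * x' = -1] (mod int p)"
      using cong_minus_minus_iff mod_inv[OF False] unfolding x'_def
      by (metis mult_minus_right)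
    have \<chi>x': "\<chi> x * \<chi> x' = \<chi> (-1)"
      using \<chi>_cong[OF xx'] by (simp add: \<chi>_mult)
    have "conv \<chi> g x = (\<Sum>z\<in>Zp. \<chi> x * (\<chi> (x' - z) * f z) - (if int p dvd z then \<chi> (-1) * f z else 0))"
      unfolding conv_g
    proof (intro sum.cong refl)
      fix z
      show "\<chi> (x + mod_inv z) * \<chi> (- mod_inv z) * f z =
            \<chi> x * (\<chi> (x' - z) * f z) - (if int p dvd z then \<chi> (-1) * f z else 0)"
      proof (cases "int p dvd z")
        case True
        hence "\<chi> (- mod_inv z) = 0"
          by (simp add: \<chi>_eq_0_iff dvd_mod_inv_iff)
        moreover have "\<chi> (x' - z) = \<chi> x'"
          using True by (intro \<chi>_cong) (simp add: cong_iff_dvd_diff)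
        ultimately show ?thesis
          using True \<chi>x' by (simp flip: mult.assoc)
      next
        case z: False
        \<comment> \<open>With \<open>x' = -1/x\<close> the number \<open>x * z + 1\<close> is
          congruent to \<open>-x * (x' - z)\<close>; hence the transformed kernel is again a
          convolution kernel, evaluated at \<open>x'\<close>.\<close>
        have "[(x + mod_inv z) * z = x * z + 1] (mod int p)"
          using cong_add[OF cong_refl[of "x * z"] mod_inv[OF z]] by (simp add: algebra_simps)
        also have "[x * z + 1 = x * z - x * x'] (mod int p)"
          using cong_diff[OF cong_refl[of "x * z"] cong_sym[OF xx']] by simp
        also have "x * z - x * x' = x * ((-1) * (x' - z))"
          by (simp add: algebra_simps)
        finally have "\<chi> (x + mod_inv z) * \<chi> z = \<chi> x * (\<chi> (-1) * \<chi> (x' - z))"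
          using \<chi>_cong by (metis \<chi>_mult)
        moreover have "\<chi> (- mod_inv z) = \<chi> (-1) * \<chi> z"
          using \<chi>_mult[of "-1" "mod_inv z"] \<chi>_inv[OF z] by simp
        moreover have "\<chi> (-1) * \<chi> (-1) = 1"
          using \<chi>_mult[of "-1" "-1"] \<chi>_1 by simp
        ultimately have "\<chi> (x + mod_inv z) * \<chi> (- mod_inv z) = \<chi> x * \<chi> (x' - z)"
          by (metis (no_types, opaque_lifting) mult.assoc mult.left_commute mult_1)
        with z show ?thesis by simp
      qed
    qed
    also have "\<dots> = \<chi> x * conv \<chi> f x' - \<chi> (-1) * f 0"
      unfolding sum_subtractf delta conv_def by (simp add: sum_distrib_left)
    also have "\<dots> = l * g x - \<chi> (-1) * f 0"
      unfolding g_def eigen x'_def by simp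
    finally show ?thesis .
  qed
qed

text \<open>On the class where the transform of \<open>f\<close> may be nonzero,
  \<open>\<chi>\<close> has a constant transform, so \<open>f\<close> is an eigenvector of
  convolution with \<open>\<chi>\<close>. The transformed word has nonzero sum, and the previous
  bound applies to it.\<close>

lemma square_root_bound_even_like:
  assumes f: "periodic f" and \<epsilon>: "\<epsilon> = 1 \<or> \<epsilon> = -1"
    and zeros: "\<And>r. Legendre r (int p) = \<epsilon> \<Longrightarrow> dft f r = 0"
    and sum0: "dft f 0 = 0" and f0: "f 0 \<noteq> 0"
  shows "p \<le> (weight f)\<^sup>2"
proof -
  \<comment> \<open>The value of \<open>dft \<chi>\<close> on the class opposite to
    \<open>\<epsilon>\<close>; on the class of \<open>\<epsilon>\<close> it is
    \<open>- l\<close>.\<close>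
  define l where "l = - of_int \<epsilon> * dft \<chi> 1"
  define g where "g = (\<lambda>x. \<chi> x * f (- mod_inv x))"
  have l0: "l \<noteq> 0"
    using \<epsilon> dft_\<chi>_1_neq_0 unfolding l_def by auto
  have per_lf: "periodic (\<lambda>x. l * f x)"
    using f unfolding periodic_def by metis
  have "conv \<chi> f x = l * f x" for x
  proof (rule dft_inject[OF periodic_conv[OF periodic_\<chi>] per_lf])
    fix r
    have rhs: "dft (\<lambda>x. l * f x) r = l * dft f r"
      unfolding dft_def by (simp add: sum_distrib_left mult_ac)
    consider "int p dvd r" | "Legendre r (int p) = \<epsilon>" | "Legendre r (int p) = - \<epsilon>"
      using Legendre_cases[of r "int p"] Legendre_eq_0_iff[of r "int p"] \<epsilon> by force
    thus "dft (conv \<chi> f) r = dft (\<lambda>x. l * f x) r"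
    proof cases
      case 1
      hence "dft f r = dft f 0"
        unfolding dft_def by (intro sum.cong refl) (subst root_powi_eq_1_iff[THEN iffD2], simp_all)
      thus ?thesis using sum0 rhs by (simp add: dft_conv[OF periodic_\<chi>])
    next
      case 2
      thus ?thesis using zeros rhs by (simp add: dft_conv[OF periodic_\<chi>])
    next
      case 3
      hence "dft \<chi> r = l"
        unfolding l_def by (subst dft_\<chi>) (simp add: \<chi>_def[of r])
      thus ?thesis using rhs by (simp add: dft_conv[OF periodic_\<chi>])
    qed
  qed
  hence "conv \<chi> g x = l * g x - \<chi> (-1) * f 0" for x
    unfolding g_def by (intro gleason_prange f sum0)
  hence "dft (conv \<chi> g) r = dft (\<lambda>x. l * g x - \<chi> (-1) * f 0) r" for r
    by presburger
  moreover have "dft (\<lambda>x. l * g x - \<chi> (-1) * f 0) r =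
      l * dft g r - \<chi> (-1) * f 0 * (if int p dvd r then of_nat p else 0)" for r
    unfolding dft_def sum_root_powi[symmetric]
    by (simp add: sum_subtractf sum_distrib_left left_diff_distrib right_diff_distrib mult_ac)
  ultimately have dft_g:
    "dft \<chi> r * dft g r = l * dft g r - \<chi> (-1) * f 0 * (if int p dvd r then of_nat p else 0)" for r
    by (simp add: dft_conv[OF periodic_\<chi>])
  have "p \<le> (weight g)\<^sup>2"
  proof (rule square_root_bound_odd_like[OF _ \<epsilon>])
    show "periodic g"
      unfolding periodic_def g_def
      by (intro allI impI arg_cong2[of _ _ _ _ "(*)"] \<chi>_cong periodicD[OF f])
         (auto simp: cong_minus_minus_iff intro: mod_inv_cong)
  next
    fix r assume r: "Legendre r (int p) = \<epsilon>"
    hence "\<not> int p dvd r"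
      using \<epsilon> Legendre_eq_0_iff[of r "int p"] by auto
    moreover have "dft \<chi> r = - l"
      unfolding l_def by (subst dft_\<chi>) (simp add: \<chi>_def[of r] r)
    \<comment> \<open>Away from frequency 0 the inhomogeneity has transform 0, and the equation
      reads \<open>- l * dft g r = l * dft g r\<close>.\<close>
    ultimately have "2 * (l * dft g r) = 0"
      using dft_g[of r] by simp
    thus "dft g r = 0"
      using l0 two_neq_0 by simp
  next
    have "\<chi> (-1) \<noteq> 0"
      using p_gt_2 by (simp add: \<chi>_eq_0_iff)
    \<comment> \<open>If \<open>dft g 0\<close> were 0, the equation at frequency 0 would leave
      \<open>\<chi> (-1) * f 0 * of_nat p = 0\<close>.\<close>
    thus "dft g 0 \<noteq> 0"
      using dft_g[of 0] f0 of_nat_p_neq_0 by auto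
  qed
  \<comment> \<open>The substitution maps the support of \<open>g\<close> injectively into that of
    \<open>f\<close>.\<close>
  moreover have "weight g \<le> weight f"
    unfolding weight_def
  proof (rule card_inj_on_le[where f = "\<lambda>x. (- mod_inv x) mod int p"])
    show "inj_on (\<lambda>x. (- mod_inv x) mod int p) {x \<in> Zp. g x \<noteq> 0}"
      by (rule inj_onI) (auto simp: cong_def intro!: inj_neg_mod_inv)
    have "f ((- mod_inv x) mod int p) = f (- mod_inv x)" for x
      by (rule periodicD[OF f]) (simp add: cong_def)
    thus "(\<lambda>x. (- mod_inv x) mod int p) ` {x \<in> Zp. g x \<noteq> 0} \<subseteq> {x \<in> Zp. f x \<noteq> 0}"
      using p_pos by (auto simp: g_def)
  qed (rule finite_support)
  ultimately show ?thesis
    using power_mono[of "weight g" "weight f" 2] by linarith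
qed

text \<open>When the sum is zero, translate a support point to the origin. Translation only
  multiplies the transform by powers of \<open>\<zeta>\<close>, so its zeros are kept.\<close>

theorem square_root_bound:
  assumes f: "periodic f" and \<epsilon>: "\<epsilon> = 1 \<or> \<epsilon> = -1"
    and zeros: "\<And>r. Legendre r (int p) = \<epsilon> \<Longrightarrow> dft f r = 0"
    and x0: "f x\<^sub>0 \<noteq> 0"
  shows "p \<le> (weight f)\<^sup>2"
proof (cases "dft f 0 = 0")
  case False
  thus ?thesis using square_root_bound_odd_like assms by blast
next
  case True
  define g where "g = (\<lambda>x. f (x + x\<^sub>0))"
  have per_g: "periodic g"
    unfolding periodic_def g_def by (auto intro!: periodicD[OF f] cong_add)
  have dft_g: "dft g r * \<zeta> powi (r * x\<^sub>0) = dft f r" for r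
  proof -
    have per: "periodic (\<lambda>x. f x * \<zeta> powi (r * x))"
      unfolding periodic_def
      by (intro allI impI arg_cong2[of _ _ _ _ "(*)"] root_powi_cong cong_scalar_left periodicD[OF f])
    show ?thesis
      unfolding dft_def g_def sum_shift[OF per, of x\<^sub>0, symmetric]
      by (simp add: sum_distrib_left distrib_left power_int_add root_neq_0 mult_ac)
  qed
  have "p \<le> (weight g)\<^sup>2"
  proof (rule square_root_bound_even_like[OF per_g \<epsilon>])
    show "dft g r = 0" if "Legendre r (int p) = \<epsilon>" for r
      using dft_g[of r] zeros[OF that] root_neq_0 by simp
    show "dft g 0 = 0"
      using dft_g[of 0] True by simp
    show "g 0 \<noteq> 0" using x0 by (simp add: g_def)
  qed
  moreover have "weight g \<le> weight f"
    unfolding weight_def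
  proof (rule card_inj_on_le[where f = "\<lambda>x. (x + x\<^sub>0) mod int p"])
    show "inj_on (\<lambda>x. (x + x\<^sub>0) mod int p) {x \<in> Zp. g x \<noteq> 0}"
      by (rule inj_onI) (auto intro!: Zp_cong_eq simp: cong_def[symmetric] cong_add_rcancel)
    have "f ((x + x\<^sub>0) mod int p) = f (x + x\<^sub>0)" for x
      by (rule periodicD[OF f]) (simp add: cong_def)
    thus "(\<lambda>x. (x + x\<^sub>0) mod int p) ` {x \<in> Zp. g x \<noteq> 0} \<subseteq> {x \<in> Zp. f x \<noteq> 0}"
      using p_pos by (auto simp: g_def)
  qed (rule finite_support)
  ultimately show ?thesis
    using power_mono[of "weight g" "weight f" 2] by linarith
qed

end

section \<open>The two codes\<close>

lemma finite_hamming_weight_image: "finite (hamming_weight n ` S)"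
proof (rule finite_subset)
  show "hamming_weight n ` S \<subseteq> {..n}"
  proof
    fix k assume "k \<in> hamming_weight n ` S"
    then obtain c where "c \<in> S" "k = card {i. i < n \<and> c i \<noteq> 0}"
      unfolding hamming_weight_def by blast
    note this(2)
    also have "\<dots> \<le> card {..<n}"
      by (intro card_mono) auto
    finally show "k \<in> {..n}" by simp
  qed
qed simp

lemma min_distance_le:
  assumes "c \<in> S" "i < n" "c i \<noteq> 0"
  shows "min_distance n S \<le> hamming_weight n c"
  unfolding min_distance_def
  by (rule Min_le[OF finite_hamming_weight_image]) (use assms in auto)

lemma min_distance_attained:
  assumes "c \<in> S" "i < n" "c i \<noteq> 0"
  obtains c' j where "c' \<in> S" "j < n" "c' j \<noteq> 0" "min_distance n S = hamming_weight n c'"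
proof -
  have "min_distance n S \<in> hamming_weight n ` {c \<in> S. \<exists>i<n. c i \<noteq> 0}"
    unfolding min_distance_def
    by (rule Min_in[OF finite_hamming_weight_image]) (use assms in auto)
  thus ?thesis using that by auto
qed

text \<open>If \<open>\<alpha> ^ k = 1\<close>, the first \<open>k\<close> powers already exhaust
  the nonzero elements, which bounds \<open>k\<close> from below. By pigeonhole two of the first
  \<open>card UNIV\<close> powers agree, and the lower bound fixes the difference of their
  exponents.\<close>

lemma primitive_element_power_eq_1:
  fixes \<alpha> :: "'a::{field,finite}"
  assumes "primitive_element \<alpha>"
  shows "\<alpha> ^ (card (UNIV :: 'a set) - 1) = 1"
    and "0 < k \<Longrightarrow> \<alpha> ^ k = 1 \<Longrightarrow> card (UNIV :: 'a set) - 1 \<le> k"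
proof -
  have card: "card (- {0 :: 'a}) = card (UNIV :: 'a set) - 1"
    by (simp add: Compl_eq_Diff_UNIV)
  have pos: "card (UNIV :: 'a set) > 0"
    by (simp add: finite_UNIV_card_ge_0)
  have lower: "card (UNIV :: 'a set) - 1 \<le> k" if k: "0 < k" "\<alpha> ^ k = 1" for k
  proof -
    have "- {0 :: 'a} \<subseteq> (\<lambda>i. \<alpha> ^ i) ` {..<k}"
    proof
      fix x :: 'a assume "x \<in> - {0}"
      then obtain i where "x = \<alpha> ^ i"
        using assms unfolding primitive_element_def by auto
      also have "\<alpha> ^ i = \<alpha> ^ (k * (i div k) + i mod k)" by simp
      also have "\<dots> = \<alpha> ^ (i mod k)"
        by (simp only: power_add power_mult k power_one mult_1)
      finally show "x \<in> (\<lambda>i. \<alpha> ^ i) ` {..<k}"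
        using k by auto
    qed
    hence "card (- {0 :: 'a}) \<le> card {..<k}"
      by (meson card_image_le card_mono finite_imageI finite_lessThan le_trans)
    thus ?thesis using card by simp
  qed
  thus "0 < k \<Longrightarrow> \<alpha> ^ k = 1 \<Longrightarrow> card (UNIV :: 'a set) - 1 \<le> k" by blast
  have "\<alpha> \<noteq> 0" using assms unfolding primitive_element_def by blast
  hence "(\<lambda>i. \<alpha> ^ i) ` {..<card (UNIV :: 'a set)} \<subseteq> - {0}" by auto
  hence "card ((\<lambda>i. \<alpha> ^ i) ` {..<card (UNIV :: 'a set)}) \<le> card (- {0 :: 'a})"
    by (intro card_mono) auto
  hence "card ((\<lambda>i. \<alpha> ^ i) ` {..<card (UNIV :: 'a set)}) < card {..<card (UNIV :: 'a set)}"
    using card pos by simp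
  hence "\<not> inj_on (\<lambda>i. \<alpha> ^ i) {..<card (UNIV :: 'a set)}"
    by (rule pigeonhole)
  then obtain i j where ij: "i < j" "j < card (UNIV :: 'a set)" "\<alpha> ^ i = \<alpha> ^ j"
    unfolding inj_on_def by (metis lessThan_iff linorder_neqE_nat)
  hence eq: "\<alpha> ^ (j - i) = 1"
    using \<open>\<alpha> \<noteq> 0\<close> by (simp add: power_diff)
  moreover have "j - i = card (UNIV :: 'a set) - 1"
    using lower[OF _ eq] ij by simp
  ultimately show "\<alpha> ^ (card (UNIV :: 'a set) - 1) = 1" by simp
qed

section \<open>The field, the root of unity and the orbits of multiplication by 9\<close>

locale ternary_negacyclic =
  fixes \<rho> :: nat and \<beta> :: "'a::{field,finite}"
  assumes prime_\<rho>: "prime \<rho>" and \<rho>_gt_3: "\<rho> > 3" and ord_\<rho>: "ord \<rho> 3 = \<rho> - 1"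
    and char_3: "CHAR('a) = 3" and card_field: "card (UNIV :: 'a set) = 3 ^ (\<rho> - 1)"
    and \<beta>_pow: "\<beta> ^ (2 * \<rho>) = -1" and \<beta>_pow_4: "\<beta> ^ 4 \<noteq> 1"
begin

text \<open>The order of \<open>\<beta>\<close> divides \<open>4 * \<rho>\<close> but neither
  \<open>2 * \<rho>\<close> nor 4, so it is \<open>4 * \<rho>\<close>. Hence
  \<open>\<beta> ^ 2\<close> has order \<open>2 * \<rho>\<close>, and negating it leaves a root of
  unity of odd order \<open>\<rho>\<close>.\<close>

abbreviation \<zeta> :: 'a where "\<zeta> \<equiv> - (\<beta> ^ 2)"

lemma odd_\<rho>: "odd \<rho>"
  using prime_\<rho> \<rho>_gt_3 prime_odd_nat by auto

lemma two_neq_zero: "(2 :: 'a) \<noteq> 0"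
  using of_nat_eq_0_iff_char_dvd[of 2, where 'a = 'a] char_3 by auto

sublocale prime_root_of_unity \<rho> \<zeta>
proof
  show "\<zeta> ^ \<rho> = 1"
    using odd_\<rho> \<beta>_pow by (simp flip: power_mult)
  show "\<zeta> \<noteq> 1"
  proof
    assume "\<zeta> = 1"
    hence "(\<beta> ^ 2) ^ 2 = 1" by (metis power2_minus power_one)
    thus False using \<beta>_pow_4 by (simp flip: power_mult)
  qed
  have "\<not> 3 dvd \<rho>"
    using prime_\<rho> \<rho>_gt_3 prime_nat_iff[of \<rho>] by auto
  thus "of_nat \<rho> \<noteq> (0 :: 'a)"
    using of_nat_eq_0_iff_char_dvd[of \<rho>, where 'a = 'a] char_3 by auto
qed (use prime_\<rho> \<rho>_gt_3 two_neq_zero in auto)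

lemma \<beta>_neq_0: "\<beta> \<noteq> 0"
  using root_neq_0 by auto

lemma frobenius_sum: "sum f A ^ (3 ^ k) = (\<Sum>i\<in>A. f i ^ (3 ^ k) :: 'a)"
  by (rule freshmans_dream_sum'[of _ k]) (simp_all add: char_3)

lemma frobenius_add: "(x + y :: 'a) ^ (3 ^ k) = x ^ (3 ^ k) + y ^ (3 ^ k)"
  by (rule freshmans_dream'[of _ k]) (simp_all add: char_3)

lemma nine_power: "(9 :: nat) ^ j = 3 ^ (2 * j)"
  by (simp add: power_mult)

lemma fixed_power:
  assumes "(x :: 'a) ^ q = x" shows "x ^ (q ^ j) = x"
  by (induction j) (simp_all add: power_mult assms)

lemma sum_Zp: "(\<Sum>x\<in>Zp. f x) = (\<Sum>i<\<rho>. f (int i))"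
  by (rule sum.reindex_bij_witness[of _ int nat]) auto

lemma Legendre_3: "Legendre 3 (int \<rho>) = -1"
  using Legendre_primitive_root[OF prime_\<rho> _ ord_\<rho>] \<rho>_gt_3 by simp

lemma Legendre_9_power: "Legendre (a * 9 ^ j) (int \<rho>) = Legendre a (int \<rho>)"
proof -
  have "(9 :: int) = 3 ^ 2" by simp
  hence "Legendre (9 ^ j) (int \<rho>) = 1"
    using Legendre_power[OF prime_\<rho> p_gt_2, of 3 "2 * j"] Legendre_3
    by (simp add: power_mult)
  thus ?thesis
    using Legendre_mult[OF prime_\<rho> p_gt_2] by simp
qed

lemma powers_of_3: "bij_betw (\<lambda>i. 3 ^ i mod \<rho>) {..<\<rho> - 1} (totatives \<rho>)"
proof -
  have "residue_primroot \<rho> 3"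
    unfolding residue_primroot_def using prime_\<rho> \<rho>_gt_3 ord_\<rho> ord_eq_0[of \<rho> 3]
    by (auto simp: totient_prime)
  thus ?thesis
    using residue_primroot_is_generator[of \<rho> 3] prime_\<rho> \<rho>_gt_3 by (simp add: totient_prime)
qed

lemma cong_mult_9_power_imp_eq:
  assumes h: "\<not> int \<rho> dvd h" and ij: "i < (\<rho> - 1) div 2" "j < (\<rho> - 1) div 2"
    and cong: "[h * 9 ^ i = h * 9 ^ j] (mod int \<rho>)"
  shows "i = j"
proof -
  have "[(9 :: int) ^ i = 9 ^ j] (mod int \<rho>)"
    using cong h coprime_p_iff cong_mult_lcancel by blast
  hence "[(9 :: nat) ^ i = 9 ^ j] (mod \<rho>)"
    by (simp flip: cong_int_iff)
  hence "3 ^ (2 * i) mod \<rho> = 3 ^ (2 * j) mod \<rho>"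
    by (simp add: cong_def nine_power)
  moreover have "2 * i < \<rho> - 1" "2 * j < \<rho> - 1"
    using ij by auto
  ultimately show "i = j"
    using powers_of_3 unfolding bij_betw_def by (auto dest: inj_onD)
qed

text \<open>Each of the two classes of nonzero residues is a single orbit under multiplication by 9:
  as 3 is a primitive root, \<open>s = h * 3 ^ i\<close> modulo \<open>\<rho>\<close> for some
  \<open>i\<close>, and equal symbols make \<open>i\<close> even.\<close>

lemma Legendre_eq_imp_cong:
  assumes h: "\<not> int \<rho> dvd h" and eq: "Legendre s (int \<rho>) = Legendre h (int \<rho>)"
  obtains j where "j < (\<rho> - 1) div 2" "[s = h * 9 ^ j] (mod int \<rho>)"
proof -
  obtain h' where h': "[h * h' = 1] (mod int \<rho>)"
    using h coprime_p_iff cong_solve_coprime_int by blast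
  define t where "t = nat ((s * h') mod int \<rho>)"
  have t: "int t = (s * h') mod int \<rho>"
    unfolding t_def using p_pos by simp
  have s: "[h * int t = s] (mod int \<rho>)"
  proof -
    have "[h * int t = h * (s * h')] (mod int \<rho>)"
      unfolding t by (intro cong_scalar_left) (simp add: cong_def)
    also have "h * (s * h') = s * (h * h')" by simp
    also have "[\<dots> = s * 1] (mod int \<rho>)" by (intro cong_scalar_left h')
    finally show ?thesis by simp
  qed
  have "\<not> int \<rho> dvd s"
    using h eq Legendre_eq_0_iff[of s "int \<rho>"] Legendre_eq_0_iff[of h "int \<rho>"] by simp
  hence nd: "\<not> \<rho> dvd t"
    using s cong_dvd_iff by fastforce
  hence "coprime t \<rho>" "0 < t"
    using prime_\<rho> prime_imp_coprime coprime_commute by (blast, auto intro: Nat.gr0I)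
  moreover have "t < \<rho>"
    using t p_pos by (metis of_nat_less_iff pos_mod_bound)
  ultimately have "t \<in> totatives \<rho>"
    by (simp add: totatives_def)
  then obtain i where i: "i < \<rho> - 1" "t = 3 ^ i mod \<rho>"
    using powers_of_3 unfolding bij_betw_def by auto
  have "[int t = 3 ^ i] (mod int \<rho>)"
    using i by (simp add: cong_def zmod_int)
  hence si: "[s = h * 3 ^ i] (mod int \<rho>)"
    using s cong_trans cong_sym cong_scalar_left by blast
  hence "Legendre s (int \<rho>) = Legendre h (int \<rho>) * (-1) ^ i"
    using Legendre_cong[OF si] prime_\<rho> p_gt_2 by (simp add: Legendre_mult Legendre_power Legendre_3)
  hence "even i"
    using eq h Legendre_eq_0_iff[of h "int \<rho>"] by (cases "even i") auto
  then obtain j where j: "i = 2 * j" by blast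
  show ?thesis
  proof (rule that[of j])
    show "j < (\<rho> - 1) div 2" using i j odd_\<rho> by (elim oddE) simp
    show "[s = h * 9 ^ j] (mod int \<rho>)" using si by (simp add: j power_mult)
  qed
qed

text \<open>The values of \<open>u\<close> lie in GF(9), so raising to the power 9 only moves the
  roots of unity. Zeros of the transform therefore fill whole orbits of multiplication by 9.\<close>

lemma dft_frobenius:
  assumes "\<And>x. u x ^ 9 = u x"
  shows "dft u r ^ (9 ^ j) = dft u (r * 9 ^ j)"
  unfolding dft_def frobenius_sum[of _ _ "2 * j", folded nine_power]
  by (intro sum.cong refl)
     (simp add: power_mult_distrib power_int_power' fixed_power[OF assms] mult_ac)

section \<open>Trace words and their spectra\<close>

definition trace_word :: "nat \<Rightarrow> 'a \<Rightarrow> 'a \<Rightarrow> int \<Rightarrow> 'a" where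
  "trace_word h a b x = a + rel_trace 9 ((\<rho> - 1) div 2) (b * \<zeta> powi (int h * x))"

lemma periodic_trace_word: "periodic (trace_word h a b)"
proof -
  have "\<zeta> powi (int h * x) = \<zeta> powi (int h * y)" if "[x = y] (mod int \<rho>)" for x y
    using that by (intro root_powi_cong cong_scalar_left)
  thus ?thesis
    unfolding periodic_def trace_word_def by metis
qed

text \<open>Expanding the trace gives characters of frequencies 0 and \<open>int h * 9 ^ j\<close>.
  With the sign convention of \<open>dft\<close> they are seen only at 0 and in the class of
  \<open>- int h\<close>.\<close>

lemma dft_trace_word:
  assumes h: "\<not> \<rho> dvd h" and r: "Legendre r (int \<rho>) = - Legendre (- int h) (int \<rho>)"
  shows "dft (trace_word h a b) r = 0"
proof -
  have "Legendre (- int h) (int \<rho>) \<noteq> 0"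
    using h by (simp add: Legendre_eq_0_iff)
  hence r0: "\<not> int \<rho> dvd r"
    using r Legendre_eq_0_iff[of r "int \<rho>"] by simp
  have nd: "\<not> int \<rho> dvd int h * 9 ^ j + r" for j
  proof
    assume "int \<rho> dvd int h * 9 ^ j + r"
    hence "[r = (- int h) * 9 ^ j] (mod int \<rho>)"
      by (simp add: cong_iff_dvd_diff add.commute)
    hence "Legendre r (int \<rho>) = Legendre (- int h) (int \<rho>)"
      using Legendre_cong Legendre_9_power by metis
    thus False
      using r \<open>Legendre (- int h) (int \<rho>) \<noteq> 0\<close> by simp
  qed
  have "trace_word h a b x * \<zeta> powi (r * x) = a * \<zeta> powi (r * x) +
      (\<Sum>j<(\<rho> - 1) div 2. b ^ (9 ^ j) * \<zeta> powi ((int h * 9 ^ j + r) * x))" for x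
    unfolding trace_word_def rel_trace_def
    by (simp add: sum_distrib_left power_mult_distrib power_int_power' power_int_add
         \<beta>_neq_0 algebra_simps)
  hence "dft (trace_word h a b) r = a * (\<Sum>x\<in>Zp. \<zeta> powi (r * x)) +
      (\<Sum>j<(\<rho> - 1) div 2. b ^ (9 ^ j) * (\<Sum>x\<in>Zp. \<zeta> powi ((int h * 9 ^ j + r) * x)))"
    unfolding dft_def
    by (simp add: sum.distrib sum_distrib_left) (rule sum.swap)
  thus ?thesis
    by (simp only: sum_root_powi r0 nd if_False mult_zero_right sum.neutral_const add_0)
qed

text \<open>One zero at \<open>- k\<close> spreads to its whole class, so inversion leaves frequency
  0 and the orbit of \<open>h\<close>. The coefficients on that orbit are conjugates of a single
  one, and their sum is a relative trace.\<close>

lemma trace_word_exists: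
  assumes u: "periodic u" "\<And>x. u x ^ 9 = u x" and h: "\<not> \<rho> dvd h"
    and k: "dft u (- k) = 0" "Legendre k (int \<rho>) = - Legendre (int h) (int \<rho>)"
  obtains a b where "a ^ 9 = a" "\<And>x. u x = trace_word h a b x"
proof -
  define d where "d = (\<rho> - 1) div 2"
  define a where "a = dft u 0 / of_nat \<rho>"
  define b where "b = dft u (- int h) / of_nat \<rho>"
  have h': "\<not> int \<rho> dvd int h" using h by simp
  have Lh: "Legendre (int h) (int \<rho>) \<noteq> 0"
    using h by (simp add: Legendre_eq_0_iff)
  have k': "\<not> int \<rho> dvd k"
    using k(2) Lh Legendre_eq_0_iff[of k "int \<rho>"] by simp
  have dft_cong: "dft u r = dft u s" if "[r = s] (mod int \<rho>)" for r s
    unfolding dft_def using that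
    by (intro sum.cong refl arg_cong2[of _ _ _ _ "(*)"] root_powi_cong cong_scalar_right)
  have zero: "dft u (- s) = 0" if s: "Legendre s (int \<rho>) = Legendre k (int \<rho>)" for s
  proof -
    obtain j where "[s = k * 9 ^ j] (mod int \<rho>)"
      using Legendre_eq_imp_cong[OF k' s] by blast
    hence "[- s = - k * 9 ^ j] (mod int \<rho>)"
      by (simp add: cong_minus_minus_iff)
    from dft_cong[OF this] have "dft u (- s) = dft u (- k) ^ (9 ^ j)"
      by (simp only: dft_frobenius[OF u(2)])
    thus ?thesis using k by (simp add: power_0_left)
  qed
  \<comment> \<open>The Frobenius map fixes the prime field, so normalising by \<open>\<rho>\<close>
    commutes with conjugation.\<close>
  have nat_fixed: "of_nat n ^ (9 ^ j) = (of_nat n :: 'a)" for n j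
    by (induction n) (simp_all add: nine_power frobenius_add power_0_left)
  have "of_nat \<rho> * u x = of_nat \<rho> * trace_word h a b x" for x
  proof -
    define F where "F = (\<lambda>s. dft u (- s) * \<zeta> powi (s * x))"
    have per_F: "periodic F"
      unfolding periodic_def F_def
      by (intro allI impI arg_cong2[of _ _ _ _ "(*)"] root_powi_cong cong_scalar_right dft_cong)
         (auto simp: cong_minus_minus_iff)
    \<comment> \<open>Reflecting the frequency turns the negative exponents of inversion into the
      positive ones of \<open>trace_word\<close>.\<close>
    have "of_nat \<rho> * u x = (\<Sum>s\<in>Zp. F (0 - s))"
      unfolding dft_inversion[OF u(1)] F_def by simp
    also have "\<dots> = (\<Sum>s\<in>Zp. F s)"
      by (rule sum_reflect[OF per_F])
    also have "\<dots> = (\<Sum>s \<in> insert 0 ((\<lambda>j. int h * 9 ^ j mod int \<rho>) ` {..<d}). F s)"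
    proof (rule sum.mono_neutral_right)
      show "insert 0 ((\<lambda>j. int h * 9 ^ j mod int \<rho>) ` {..<d}) \<subseteq> Zp"
        using p_pos by auto
      show "\<forall>s\<in>Zp - insert 0 ((\<lambda>j. int h * 9 ^ j mod int \<rho>) ` {..<d}). F s = 0"
      proof
        fix s assume s: "s \<in> Zp - insert 0 ((\<lambda>j. int h * 9 ^ j mod int \<rho>) ` {..<d})"
        have "Legendre s (int \<rho>) \<noteq> Legendre (int h) (int \<rho>)"
        proof
          assume "Legendre s (int \<rho>) = Legendre (int h) (int \<rho>)"
          from Legendre_eq_imp_cong[OF h' this] obtain j
            where "j < d" "[s = int h * 9 ^ j] (mod int \<rho>)" unfolding d_def by blast
          with s show False by (auto simp: cong_def)
        qed
        moreover have "Legendre s (int \<rho>) \<noteq> 0"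
          using s by (auto simp: Legendre_eq_0_iff dest: zdvd_imp_le)
        ultimately have "Legendre s (int \<rho>) = Legendre k (int \<rho>)"
          using k(2) Lh Legendre_cases[of s "int \<rho>"] Legendre_cases[of "int h" "int \<rho>"] by auto
        thus "F s = 0" using zero by (simp add: F_def)
      qed
    qed simp
    also have "\<dots> = F 0 + (\<Sum>s \<in> (\<lambda>j. int h * 9 ^ j mod int \<rho>) ` {..<d}. F s)"
    proof (rule sum.insert)
      have "\<not> int \<rho> dvd int h * 9 ^ j" for j
        using Lh Legendre_eq_0_iff[of "int h * 9 ^ j" "int \<rho>"] by (simp add: Legendre_9_power)
      thus "0 \<notin> (\<lambda>j. int h * 9 ^ j mod int \<rho>) ` {..<d}"
        by (auto simp: dvd_eq_mod_eq_0)
    qed simp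
    also have "(\<Sum>s \<in> (\<lambda>j. int h * 9 ^ j mod int \<rho>) ` {..<d}. F s) =
               (\<Sum>j<d. F (int h * 9 ^ j mod int \<rho>))"
    proof (rule sum.reindex[unfolded o_def], rule inj_onI)
      fix i j assume "i \<in> {..<d}" "j \<in> {..<d}" "int h * 9 ^ i mod int \<rho> = int h * 9 ^ j mod int \<rho>"
      thus "i = j"
        using cong_mult_9_power_imp_eq[OF h', of i j] by (simp add: d_def cong_def)
    qed
    also have "\<dots> = (\<Sum>j<d. of_nat \<rho> * (b * \<zeta> powi (int h * x)) ^ (9 ^ j))"
    proof (intro sum.cong refl)
      fix j
      have "F (int h * 9 ^ j mod int \<rho>) = F (int h * 9 ^ j)"
        by (rule periodicD[OF per_F]) (simp add: cong_def)
      also have "\<dots> = dft u (- int h) ^ (9 ^ j) * \<zeta> powi (int h * x * 9 ^ j)"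
        unfolding F_def dft_frobenius[OF u(2)] by (simp add: mult_ac)
      also have "dft u (- int h) ^ (9 ^ j) = of_nat \<rho> * b ^ (9 ^ j)"
        using of_nat_p_neq_0 unfolding b_def by (simp add: power_divide nat_fixed)
      finally show "F (int h * 9 ^ j mod int \<rho>) = of_nat \<rho> * (b * \<zeta> powi (int h * x)) ^ (9 ^ j)"
        by (simp add: power_mult_distrib power_int_power' mult_ac)
    qed
    also have "F 0 = of_nat \<rho> * a"
      using of_nat_p_neq_0 by (simp add: F_def a_def)
    finally show ?thesis
      unfolding trace_word_def rel_trace_def d_def by (simp add: distrib_left sum_distrib_left)
  qed
  hence "u x = trace_word h a b x" for x
    using of_nat_p_neq_0 by simp
  moreover have "a ^ 9 = a"
    using dft_frobenius[of u 0 1] u(2) nat_fixed[of \<rho> 1] unfolding a_def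
    by (simp add: power_divide)
  ultimately show ?thesis using that by blast
qed

text \<open>The sign arises from \<open>\<beta> ^ 2 = - \<zeta>\<close> with \<open>h\<close> odd;
  it is fixed by powers of 9 and so leaves the trace.\<close>

lemma Cbar_word_eq_trace_word:
  assumes "odd h"
  shows "a * (-1) ^ i + rel_trace 9 ((\<rho> - 1) div 2) (b * \<beta> ^ (2 * h * i)) =
         (-1) ^ i * trace_word h a b (int i)"
proof -
  have "\<beta> ^ (2 * h * i) = (- \<zeta>) ^ (h * i)"
    by (simp add: power_mult)
  also have "\<dots> = (-1) ^ i * \<zeta> ^ (h * i)"
    using assms by (cases "even i") (simp_all add: power_minus_odd power_minus_even uminus_power_if)
  finally have eq: "\<beta> ^ (2 * h * i) = (-1) ^ i * \<zeta> powi (int h * int i)"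
    by (simp flip: of_nat_mult)
  have sign: "((-1 :: 'a) ^ i) ^ (9 ^ j) = (-1) ^ i" for j
    by (cases "even i") auto
  have "rel_trace 9 d ((-1) ^ i * y) = (-1) ^ i * rel_trace 9 d y" for d and y :: 'a
    unfolding rel_trace_def power_mult_distrib sign sum_distrib_left ..
  from this[of _ "b * \<zeta> powi (int h * int i)"] show ?thesis
    unfolding eq trace_word_def by (simp add: distrib_left mult_ac)
qed

lemma hamming_weight_eq_weight:
  assumes "\<And>i. i < \<rho> \<Longrightarrow> c i = (-1) ^ i * u (int i)"
  shows "hamming_weight \<rho> c = weight u"
proof -
  have "{i. i < \<rho> \<and> c i \<noteq> 0} = {i. i < \<rho> \<and> u (int i) \<noteq> 0}"
    using assms by auto
  moreover have "bij_betw int {i. i < \<rho> \<and> u (int i) \<noteq> 0} {x \<in> Zp. u x \<noteq> 0}"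
    by (rule bij_betwI[of _ _ _ nat]) auto
  note bij_betw_same_card[OF this]
  ultimately show ?thesis
    unfolding hamming_weight_def weight_def by simp
qed

lemma Cbar_dual_weight_bound:
  assumes h: "odd h" "\<not> \<rho> dvd h"
    and c: "c \<in> code_Cbar_dual (\<rho> - 1) \<rho> h \<beta>" "i < \<rho>" "c i \<noteq> 0"
  shows "\<rho> \<le> (hamming_weight \<rho> c)\<^sup>2"
proof -
  obtain a b where ab: "c = (\<lambda>i. if i < \<rho> then a * (-1) ^ i + rel_trace 9 ((\<rho> - 1) div 2) (b * \<beta> ^ (2*h*i)) else 0)"
    using c(1) unfolding code_Cbar_dual_def by blast
  have eq: "c i = (-1) ^ i * trace_word h a b (int i)" if "i < \<rho>" for i
    using that Cbar_word_eq_trace_word[OF h(1), of a i b] by (simp add: ab)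
  have "\<rho> \<le> (weight (trace_word h a b))\<^sup>2"
  proof (rule square_root_bound[OF periodic_trace_word])
    have "Legendre (- int h) (int \<rho>) \<noteq> 0"
      using h by (simp add: Legendre_eq_0_iff)
    thus "- Legendre (- int h) (int \<rho>) = 1 \<or> - Legendre (- int h) (int \<rho>) = -1"
      using Legendre_cases[of "- int h" "int \<rho>"] by auto
    show "trace_word h a b (int i) \<noteq> 0"
      using eq[OF c(2)] c(3) by auto
  qed (rule dft_trace_word[OF h(2)])
  thus ?thesis
    using hamming_weight_eq_weight[of c, OF eq] by simp
qed

end

section \<open>The dual of the ternary code and its dimension\<close>

context ternary_negacyclic
begin

abbreviation \<theta> :: 'a where "\<theta> \<equiv> inverse \<beta>"

lemma \<theta>_pow: "\<theta> ^ (2 * \<rho>) = -1"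
  by (simp only: power_inverse \<beta>_pow) simp

lemma subfield_GF_3: "subfield_GF 3 = {0, 1, -1 :: 'a}"
proof -
  have "x ^ 3 = x \<longleftrightarrow> x * (x - 1) * (x + 1) = 0" for x :: 'a
    by (simp add: power3_eq_cube algebra_simps)
  hence "x ^ 3 = x \<longleftrightarrow> x = 0 \<or> x = 1 \<or> x = -1" for x :: 'a
    by (simp add: eq_neg_iff_add_eq_0)
  thus ?thesis
    unfolding subfield_GF_def by auto
qed

lemma card_subfield_GF_3: "card (subfield_GF 3 :: 'a set) = 3"
proof -
  have "(1 :: 'a) \<noteq> -1"
    using two_neq_zero by (simp add: eq_neg_iff_add_eq_0)
  thus ?thesis
    by (simp add: subfield_GF_3)
qed

text \<open>For \<open>y \<noteq> 0\<close> the products \<open>a * y\<close> run through the field,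
  but the trace is a nonzero polynomial of degree at most \<open>3 ^ (\<rho> - 2)\<close> and cannot
  have that many roots.\<close>

lemma rel_trace_nondegenerate:
  assumes "\<And>a. rel_trace 3 (\<rho> - 1) (a * y) = 0"
  shows "y = (0 :: 'a)"
proof (rule ccontr)
  assume y: "y \<noteq> 0"
  define P :: "'a poly" where "P = (\<Sum>j<\<rho> - 1. monom 1 (3 ^ j))"
  have "poly P x = 0" for x
    using assms[of "x / y"] y by (simp add: P_def rel_trace_def poly_sum poly_monom)
  hence "card (UNIV :: 'a set) \<le> degree P" if "P \<noteq> 0"
    using card_poly_roots_bound[OF that] by simp
  moreover have "P \<noteq> 0"
  proof
    assume "P = 0"
    hence "0 = coeff P 1" by simp
    also have "\<dots> = (\<Sum>j<\<rho> - 1. if j = 0 then 1 else 0)"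
      unfolding P_def coeff_sum by (intro sum.cong refl) (auto simp: coeff_monom)
    also have "\<dots> = 1" using \<rho>_gt_3 by simp
    finally show False by simp
  qed
  moreover have "degree P \<le> 3 ^ (\<rho> - 2)"
    unfolding P_def
  proof (rule degree_sum_le)
    fix j assume "j \<in> {..<\<rho> - 1}"
    hence "(3 :: nat) ^ j \<le> 3 ^ (\<rho> - 2)"
      by (intro power_increasing) auto
    thus "degree (monom (1 :: 'a) (3 ^ j)) \<le> 3 ^ (\<rho> - 2)"
      by (simp add: degree_monom_eq)
  qed simp
  moreover have "(3 :: nat) ^ (\<rho> - 2) < 3 ^ (\<rho> - 1)"
    using \<rho>_gt_3 by (intro power_strict_increasing) auto
  ultimately show False
    using card_field by linarith
qed

text \<open>Ternary entries are fixed by the Frobenius map, so the inner product with the codeword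
  of \<open>a\<close> is the trace of \<open>a\<close> times the value at \<open>\<theta>\<close>;
  nondegeneracy does the rest.\<close>

lemma mem_dual_code_C_iff:
  "v \<in> dual_code (subfield_GF 3) (2 * \<rho>) (code_C (\<rho> - 1) \<rho> \<theta>) \<longleftrightarrow>
   (\<forall>i<2*\<rho>. v i \<in> subfield_GF 3) \<and> (\<forall>i\<ge>2*\<rho>. v i = 0) \<and> (\<Sum>i<2*\<rho>. v i * \<theta> ^ i) = 0"
proof -
  have "(\<forall>c\<in>code_C (\<rho> - 1) \<rho> \<theta>. (\<Sum>i<2*\<rho>. v i * c i) = 0) \<longleftrightarrow> (\<Sum>i<2*\<rho>. v i * \<theta> ^ i) = 0"
    if v: "\<forall>i<2*\<rho>. v i \<in> subfield_GF 3"
  proof -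
    have "(\<Sum>i<2*\<rho>. v i * rel_trace 3 (\<rho> - 1) (a * \<theta> ^ i)) =
          rel_trace 3 (\<rho> - 1) (a * (\<Sum>i<2*\<rho>. v i * \<theta> ^ i))" for a
    proof -
      have "rel_trace 3 (\<rho> - 1) (a * (\<Sum>i<2*\<rho>. v i * \<theta> ^ i)) =
            (\<Sum>j<\<rho> - 1. \<Sum>i<2*\<rho>. (v i * (a * \<theta> ^ i)) ^ (3 ^ j))"
        unfolding rel_trace_def by (simp only: sum_distrib_left frobenius_sum mult.left_commute)
      also have "\<dots> = (\<Sum>i<2*\<rho>. \<Sum>j<\<rho> - 1. v i * (a * \<theta> ^ i) ^ (3 ^ j))"
      proof (subst sum.swap, intro sum.cong refl)
        fix i j assume "i \<in> {..<2*\<rho>}"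
        hence "v i ^ (3 ^ j) = v i"
          using v by (intro fixed_power) (auto simp: subfield_GF_def)
        thus "(v i * (a * \<theta> ^ i)) ^ (3 ^ j) = v i * (a * \<theta> ^ i) ^ (3 ^ j)"
          by (simp only: power_mult_distrib)
      qed
      finally show ?thesis
        unfolding rel_trace_def by (simp add: sum_distrib_left)
    qed
    note trace = this
    have "(\<forall>c\<in>code_C (\<rho> - 1) \<rho> \<theta>. (\<Sum>i<2*\<rho>. v i * c i) = 0) \<longleftrightarrow>
          (\<forall>a. (\<Sum>i<2*\<rho>. v i * rel_trace 3 (\<rho> - 1) (a * \<theta> ^ i)) = 0)"
      unfolding code_C_def by auto
    also have "\<dots> \<longleftrightarrow> (\<forall>a. rel_trace 3 (\<rho> - 1) (a * (\<Sum>i<2*\<rho>. v i * \<theta> ^ i)) = 0)"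
      by (simp only: trace)
    also have "\<dots> \<longleftrightarrow> (\<Sum>i<2*\<rho>. v i * \<theta> ^ i) = 0"
      using rel_trace_nondegenerate by (auto simp: rel_trace_def power_0_left)
    finally show ?thesis .
  qed
  thus ?thesis
    unfolding dual_code_def by auto
qed

lemma subfield_GF_3_diff:
  "x \<in> subfield_GF 3 \<Longrightarrow> y \<in> subfield_GF 3 \<Longrightarrow> x - y \<in> (subfield_GF 3 :: 'a set)"
  using frobenius_add[of x "- y" 1] by (simp add: subfield_GF_def)

text \<open>Equal conjugates of \<open>\<theta>\<close> give equal powers of \<open>\<zeta>\<close>,
  hence \<open>3 ^ i\<close> and \<open>3 ^ j\<close> agree modulo \<open>\<rho>\<close>, where 3 is
  a primitive root.\<close>

lemma conjugates_inj: "inj_on (\<lambda>j. \<theta> ^ (3 ^ j)) {..<\<rho> - 1}"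
proof (rule inj_onI)
  fix i j assume ij: "i \<in> {..<\<rho> - 1}" "j \<in> {..<\<rho> - 1}" and "\<theta> ^ (3 ^ i) = \<theta> ^ (3 ^ j)"
  hence "\<beta> ^ (3 ^ i) = \<beta> ^ (3 ^ j)"
    by (simp only: power_inverse inverse_eq_iff_eq)
  moreover have "\<zeta> ^ (3 ^ k) = - ((\<beta> ^ (3 ^ k)) ^ 2)" for k :: nat
    by (simp add: power_minus_odd mult.commute flip: power_mult)
  ultimately have "\<zeta> ^ (3 ^ i) = \<zeta> ^ (3 ^ j)" by simp
  hence "\<zeta> powi (3 ^ i) = \<zeta> powi (3 ^ j)"
    by (metis of_nat_numeral of_nat_power power_int_of_nat)
  hence "\<zeta> powi (3 ^ i - 3 ^ j) = 1"
    using root_neq_0 by (subst power_int_diff) auto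
  hence "[(3 :: int) ^ i = 3 ^ j] (mod int \<rho>)"
    by (simp only: root_powi_eq_1_iff cong_iff_dvd_diff)
  hence "[(3 :: nat) ^ i = 3 ^ j] (mod \<rho>)"
    by (simp flip: cong_int_iff)
  thus "i = j"
    using powers_of_3 ij unfolding bij_betw_def cong_def by (auto dest: inj_onD)
qed

text \<open>A ternary polynomial vanishing at \<open>\<theta>\<close> vanishes at all its
  \<open>\<rho> - 1\<close> conjugates, too many for degree at most
  \<open>\<rho> - 2\<close>.\<close>

lemma low_degree_eval_eq_0:
  assumes v: "\<And>i. i < \<rho> - 1 \<Longrightarrow> v i \<in> subfield_GF 3" and "(\<Sum>i<\<rho> - 1. v i * \<theta> ^ i) = 0"
    and "i < \<rho> - 1"
  shows "v i = 0"
proof -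
  define P where "P = (\<Sum>i<\<rho> - 1. monom (v i) i)"
  have root: "poly P (\<theta> ^ (3 ^ j)) = 0" for j
  proof -
    have "poly P (\<theta> ^ (3 ^ j)) = (\<Sum>i<\<rho> - 1. (v i * \<theta> ^ i) ^ (3 ^ j))"
      unfolding P_def poly_sum
    proof (intro sum.cong refl)
      fix i assume "i \<in> {..<\<rho> - 1}"
      hence "v i ^ (3 ^ j) = v i"
        using v by (intro fixed_power) (auto simp: subfield_GF_def)
      thus "poly (monom (v i) i) (\<theta> ^ (3 ^ j)) = (v i * \<theta> ^ i) ^ (3 ^ j)"
        by (simp only: poly_monom power_mult_distrib) (simp only: mult.commute flip: power_mult)
    qed
    also have "\<dots> = 0"
      unfolding frobenius_sum[symmetric] assms(2) by simp
    finally show ?thesis .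
  qed
  have "P = 0"
  proof (rule ccontr)
    assume P: "P \<noteq> 0"
    have "\<rho> - 1 = card ((\<lambda>j. \<theta> ^ (3 ^ j)) ` {..<\<rho> - 1})"
      using conjugates_inj by (simp only: card_image card_lessThan)
    also have "\<dots> \<le> card {x. poly P x = 0}"
      by (rule card_mono) (use root in auto)
    also have "\<dots> \<le> degree P"
      by (rule card_poly_roots_bound[OF P])
    also have "\<dots> \<le> \<rho> - 2"
      unfolding P_def by (rule degree_sum_le) (auto intro: order.trans[OF degree_monom_le])
    finally show False using \<rho>_gt_3 by simp
  qed
  hence "0 = coeff P i" by simp
  also have "\<dots> = (\<Sum>j<\<rho> - 1. if j = i then v j else 0)"
    unfolding P_def coeff_sum by (intro sum.cong refl) (auto simp: coeff_monom)
  also have "\<dots> = v i" using assms(3) by simp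
  finally show ?thesis ..
qed

text \<open>Evaluation is injective between two sets of size
  \<open>3 ^ (\<rho> - 1)\<close>.\<close>

lemma low_degree_eval_surj:
  obtains l where "l \<in> {..<\<rho> - 1} \<rightarrow>\<^sub>E subfield_GF 3" "(\<Sum>i<\<rho> - 1. l i * \<theta> ^ i) = y"
proof -
  let ?A = "{..<\<rho> - 1} \<rightarrow>\<^sub>E (subfield_GF 3 :: 'a set)"
  let ?ev = "\<lambda>l. \<Sum>i<\<rho> - 1. l i * \<theta> ^ i"
  have "inj_on ?ev ?A"
  proof (rule inj_onI)
    fix l l' assume l: "l \<in> ?A" "l' \<in> ?A" and eq: "?ev l = ?ev l'"
    have "l i - l' i = 0" if "i < \<rho> - 1" for i
    proof (rule low_degree_eval_eq_0[OF _ _ that])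
      show "l i - l' i \<in> subfield_GF 3" if "i < \<rho> - 1" for i
        using l that by (intro subfield_GF_3_diff) (auto simp: PiE_def Pi_def)
      show "(\<Sum>i<\<rho> - 1. (l i - l' i) * \<theta> ^ i) = 0"
        using eq by (simp add: left_diff_distrib sum_subtractf)
    qed
    thus "l = l'"
      using l by (intro PiE_ext[of l]) auto
  qed
  moreover have "card ?A = card (UNIV :: 'a set)"
    by (simp add: card_PiE card_subfield_GF_3 card_field)
  ultimately have "?ev ` ?A = UNIV"
    by (intro card_subset_eq) (auto simp: card_image)
  hence "y \<in> ?ev ` ?A" by (simp only: UNIV_I)
  thus ?thesis
    by (rule imageE) (rule that, simp_all only:)
qed

text \<open>The upper \<open>\<rho> + 1\<close> coordinates are free and determine the lower
  \<open>\<rho> - 1\<close> ones, which must evaluate to a prescribed field element.\<close>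

lemma card_dual_code_C:
  "card (dual_code (subfield_GF 3) (2 * \<rho>) (code_C (\<rho> - 1) \<rho> \<theta>)) = 3 ^ (\<rho> + 1)"
proof -
  let ?D = "dual_code (subfield_GF 3) (2 * \<rho>) (code_C (\<rho> - 1) \<rho> \<theta>)"
  let ?B = "{\<rho> - 1..<2 * \<rho>} \<rightarrow>\<^sub>E (subfield_GF 3 :: 'a set)"
  have split: "(\<Sum>i<2*\<rho>. f i) = (\<Sum>i<\<rho> - 1. f i) + (\<Sum>i=\<rho> - 1..<2*\<rho>. f i)" for f :: "nat \<Rightarrow> 'a"
    using sum.atLeastLessThan_concat[of 0 "\<rho> - 1" "2 * \<rho>" f] by (simp add: atLeast0LessThan)
  have "bij_betw (\<lambda>v. restrict v {\<rho> - 1..<2*\<rho>}) ?D ?B"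
    unfolding bij_betw_def
  proof
    show "inj_on (\<lambda>v. restrict v {\<rho> - 1..<2*\<rho>}) ?D"
    proof (rule inj_onI)
      fix v v' assume v: "v \<in> ?D" "v' \<in> ?D"
        and eq: "restrict v {\<rho> - 1..<2*\<rho>} = restrict v' {\<rho> - 1..<2*\<rho>}"
      note vD = v[unfolded mem_dual_code_C_iff]
      have high: "v i = v' i" if "\<rho> - 1 \<le> i" for i
      proof (cases "i < 2 * \<rho>")
        case True
        thus ?thesis using fun_cong[OF eq, of i] that by simp
      next
        case False
        thus ?thesis using vD by simp
      qed
      have "v i - v' i = 0" if "i < \<rho> - 1" for i
      proof (rule low_degree_eval_eq_0[OF _ _ that])
        show "v i - v' i \<in> subfield_GF 3" if "i < \<rho> - 1" for i
          using vD that by (intro subfield_GF_3_diff) auto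
        have "(\<Sum>i<2*\<rho>. (v i - v' i) * \<theta> ^ i) = 0"
          using vD by (simp add: left_diff_distrib sum_subtractf)
        thus "(\<Sum>i<\<rho> - 1. (v i - v' i) * \<theta> ^ i) = 0"
          unfolding split using high by simp
      qed
      with high show "v = v'"
        by (metis eq_iff_diff_eq_0 ext not_le)
    qed
    show "(\<lambda>v. restrict v {\<rho> - 1..<2*\<rho>}) ` ?D = ?B"
    proof
      show "(\<lambda>v. restrict v {\<rho> - 1..<2*\<rho>}) ` ?D \<subseteq> ?B"
        by (auto simp: dual_code_def)
      show "?B \<subseteq> (\<lambda>v. restrict v {\<rho> - 1..<2*\<rho>}) ` ?D"
      proof
        fix g assume g: "g \<in> ?B"
        obtain l where l: "l \<in> {..<\<rho> - 1} \<rightarrow>\<^sub>E subfield_GF 3"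
          "(\<Sum>i<\<rho> - 1. l i * \<theta> ^ i) = - (\<Sum>i=\<rho> - 1..<2*\<rho>. g i * \<theta> ^ i)"
          using low_degree_eval_surj by blast
        define v where "v = (\<lambda>i. if i < \<rho> - 1 then l i else if i < 2 * \<rho> then g i else 0)"
        have "(\<Sum>i<2*\<rho>. v i * \<theta> ^ i) =
              (\<Sum>i<\<rho> - 1. l i * \<theta> ^ i) + (\<Sum>i=\<rho> - 1..<2*\<rho>. g i * \<theta> ^ i)"
          unfolding split by (intro arg_cong2[of _ _ _ _ "(+)"] sum.cong) (auto simp: v_def)
        hence "(\<Sum>i<2*\<rho>. v i * \<theta> ^ i) = 0"
          unfolding l(2) by simp
        hence "v \<in> ?D"
          unfolding mem_dual_code_C_iff using l(1) g by (auto simp: v_def PiE_def Pi_def)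
        moreover have "restrict v {\<rho> - 1..<2*\<rho>} = g"
          using g by (auto simp: v_def restrict_def PiE_def extensional_def fun_eq_iff)
        ultimately show "g \<in> (\<lambda>v. restrict v {\<rho> - 1..<2*\<rho>}) ` ?D" by blast
      qed
    qed
  qed
  hence "card ?D = card ?B"
    by (rule bij_betw_same_card)
  also have "\<dots> = 3 ^ (2 * \<rho> - (\<rho> - 1))"
    by (simp add: card_PiE card_subfield_GF_3)
  also have "2 * \<rho> - (\<rho> - 1) = \<rho> + 1"
    using \<rho>_gt_3 by simp
  finally show ?thesis .
qed

section \<open>Folding ternary words into words over GF(9)\<close>

definition odd_index :: "nat \<Rightarrow> nat" where
  "odd_index t = (if 2 * t < \<rho> then 2 * t + \<rho> else 2 * t - \<rho>)"

text \<open>For \<open>t < \<rho>\<close>, \<open>odd_index t\<close> is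
  \<open>2 * t + \<rho>\<close> reduced modulo \<open>2 * \<rho>\<close>; the sign records the
  wraparound, since \<open>\<theta> ^ (2 * \<rho>) = -1\<close>.\<close>

definition odd_sign :: "nat \<Rightarrow> 'a" where
  "odd_sign t = (if 2 * t < \<rho> then 1 else -1)"

text \<open>
  Multiplication by \<open>\<theta>\<^sup>\<rho>\<close>, a square root of \<open>-1\<close> in GF(9), identifies the odd coordinates with the even
  ones, which folds a ternary word of length \<open>2\<rho>\<close> into a word of length \<open>\<rho>\<close> over GF(9).
\<close>

definition fold_word :: "(nat \<Rightarrow> 'a) \<Rightarrow> nat \<Rightarrow> 'a" where
  "fold_word v t = v (2 * t) + odd_sign t * \<theta> ^ \<rho> * v (odd_index t)"

lemma odd_odd_index: "odd (odd_index t)"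
  using odd_\<rho> by (cases "2 * t < \<rho>") (auto simp: odd_index_def)

lemma odd_index_less: "t < \<rho> \<Longrightarrow> odd_index t < 2 * \<rho>"
  by (auto simp: odd_index_def)

lemma inj_odd_index: "inj_on odd_index {..<\<rho>}"
  by (rule inj_onI) (auto simp: odd_index_def split: if_splits)

lemma index_cover:
  assumes "i < 2 * \<rho>"
  obtains t where "t < \<rho>" "i = 2 * t \<or> i = odd_index t"
proof (cases "even i")
  case True
  thus ?thesis using that[of "i div 2"] assms by auto
next
  case False
  show ?thesis
  proof (cases "i < \<rho>")
    case True
    have "2 * ((i + \<rho>) div 2) = i + \<rho>" using False odd_\<rho> by simp
    hence "odd_index ((i + \<rho>) div 2) = i" by (simp add: odd_index_def)
    moreover have "(i + \<rho>) div 2 < \<rho>" using True by simp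
    ultimately show ?thesis using that by metis
  next
    case ge: False
    have "2 * ((i - \<rho>) div 2) = i - \<rho>" using False odd_\<rho> ge by simp
    hence "odd_index ((i - \<rho>) div 2) = i" using assms ge by (simp add: odd_index_def)
    moreover have "(i - \<rho>) div 2 < \<rho>" using assms by simp
    ultimately show ?thesis using that by metis
  qed
qed

lemma \<theta>_pow_odd_index: "\<theta> ^ odd_index t = odd_sign t * \<theta> ^ \<rho> * \<theta> ^ (2 * t)"
proof (cases "2 * t < \<rho>")
  case True
  thus ?thesis by (simp add: odd_index_def odd_sign_def power_add)
next
  case False
  have "\<theta> ^ \<rho> * \<theta> ^ (2 * t) = \<theta> ^ (2 * \<rho> + (2 * t - \<rho>))"
    using False by (simp flip: power_add)
  also have "\<dots> = - (\<theta> ^ (2 * t - \<rho>))"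
    by (simp only: power_add \<theta>_pow) simp
  finally show ?thesis
    using False by (simp add: odd_index_def odd_sign_def)
qed

lemma sum_fold_word: "(\<Sum>t<\<rho>. fold_word v t * \<theta> ^ (2 * t)) = (\<Sum>i<2*\<rho>. v i * \<theta> ^ i)"
proof -
  have "{..<2*\<rho>} = (\<lambda>t. 2 * t) ` {..<\<rho>} \<union> odd_index ` {..<\<rho>}"
    using odd_index_less by (auto elim!: index_cover)
  moreover have "(\<lambda>t. 2 * t) ` {..<\<rho>} \<inter> odd_index ` {..<\<rho>} = {}"
    using odd_odd_index by (metis (no_types, lifting) disjoint_iff dvd_triv_left imageE)
  ultimately have "(\<Sum>i<2*\<rho>. v i * \<theta> ^ i) =
      (\<Sum>i\<in>(\<lambda>t. 2 * t) ` {..<\<rho>}. v i * \<theta> ^ i) + (\<Sum>i\<in>odd_index ` {..<\<rho>}. v i * \<theta> ^ i)"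
    by (simp add: sum.union_disjoint)
  also have "\<dots> = (\<Sum>t<\<rho>. v (2 * t) * \<theta> ^ (2 * t)) + (\<Sum>t<\<rho>. v (odd_index t) * \<theta> ^ odd_index t)"
    by (simp add: sum.reindex[OF inj_odd_index] sum.reindex inj_on_def)
  finally show ?thesis
    by (simp add: \<theta>_pow_odd_index fold_word_def sum.distrib algebra_simps)
qed

lemma \<theta>_pow_\<rho>_cube: "(\<theta> ^ \<rho>) ^ 3 = - (\<theta> ^ \<rho>)"
proof -
  have "(\<theta> ^ \<rho>) ^ 3 = \<theta> ^ (2 * \<rho>) * \<theta> ^ \<rho>"
    by (simp add: power3_eq_cube mult_2 flip: power_add)
  thus ?thesis by (simp only: \<theta>_pow) simp
qed

text \<open>Cubing is the conjugation of GF(9) over GF(3) and negates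
  \<open>\<theta> ^ \<rho>\<close>. Adding a folded value to its conjugate thus isolates the even
  coordinate.\<close>

lemma fold_word_cube:
  assumes "v (2 * t) \<in> subfield_GF 3" "v (odd_index t) \<in> subfield_GF 3"
  shows "fold_word v t ^ 3 = v (2 * t) - odd_sign t * \<theta> ^ \<rho> * v (odd_index t)"
proof -
  have "odd_sign t ^ 3 = odd_sign t"
    by (simp add: odd_sign_def)
  thus ?thesis
    using assms frobenius_add[of "v (2 * t)" "odd_sign t * \<theta> ^ \<rho> * v (odd_index t)" 1]
    by (simp add: fold_word_def power_mult_distrib \<theta>_pow_\<rho>_cube subfield_GF_def)
qed

lemma fold_word_eq_0:
  assumes "v (2 * t) \<in> subfield_GF 3" "v (odd_index t) \<in> subfield_GF 3" "fold_word v t = 0"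
  shows "v (2 * t) = 0 \<and> v (odd_index t) = 0"
proof -
  have "2 * v (2 * t) = fold_word v t ^ 3 + fold_word v t"
    using fold_word_cube[of v t, OF assms(1,2)] by (simp add: fold_word_def)
  hence "v (2 * t) = 0"
    using assms(3) two_neq_zero by simp
  moreover from this have "v (odd_index t) = 0"
    using assms(3) \<beta>_neq_0 by (auto simp: fold_word_def odd_sign_def split: if_splits)
  ultimately show ?thesis ..
qed

lemma fold_word_power_9:
  assumes "v (2 * t) \<in> subfield_GF 3" "v (odd_index t) \<in> subfield_GF 3"
  shows "fold_word v t ^ 9 = fold_word v t"
proof -
  define y where "y = odd_sign t * \<theta> ^ \<rho> * v (odd_index t)"
  have y: "y ^ 3 = - y"
  proof -
    have "odd_sign t ^ 3 = odd_sign t"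
      by (simp add: odd_sign_def)
    thus ?thesis
      using assms(2)
      by (simp add: y_def power_mult_distrib \<theta>_pow_\<rho>_cube subfield_GF_def)
  qed
  have "fold_word v t ^ 9 = (fold_word v t ^ 3) ^ 3"
    by (simp flip: power_mult)
  also have "\<dots> = (v (2 * t) + (- y)) ^ 3"
    using fold_word_cube[of v t, OF assms] by (simp add: y_def)
  also have "\<dots> = v (2 * t) ^ 3 + (- y) ^ 3"
    using frobenius_add[of "v (2 * t)" "- y" 1] by simp
  also have "\<dots> = fold_word v t"
    using assms(1) y by (simp add: subfield_GF_def fold_word_def y_def)
  finally show ?thesis .
qed

text \<open>A nonzero folded entry has a nonzero entry above it. Choosing one is injective, because
  even and odd indices cannot collide.\<close>

lemma fold_word_weight:
  "card {t. t < \<rho> \<and> fold_word v t \<noteq> 0} \<le> hamming_weight (2 * \<rho>) v"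
  unfolding hamming_weight_def
proof (rule card_inj_on_le[where f = "\<lambda>t. if v (2 * t) \<noteq> 0 then 2 * t else odd_index t"])
  show "inj_on (\<lambda>t. if v (2 * t) \<noteq> 0 then 2 * t else odd_index t) {t. t < \<rho> \<and> fold_word v t \<noteq> 0}"
  proof (rule inj_onI)
    fix s t
    assume st: "s \<in> {t. t < \<rho> \<and> fold_word v t \<noteq> 0}" "t \<in> {t. t < \<rho> \<and> fold_word v t \<noteq> 0}"
      and eq: "(if v (2 * s) \<noteq> 0 then 2 * s else odd_index s) = (if v (2 * t) \<noteq> 0 then 2 * t else odd_index t)"
    have "2 * s \<noteq> odd_index t" "2 * t \<noteq> odd_index s"
      using odd_odd_index by (metis dvd_triv_left)+
    with eq st inj_odd_index show "s = t"
      by (auto split: if_splits dest: inj_onD)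
  qed
  show "(\<lambda>t. if v (2 * t) \<noteq> 0 then 2 * t else odd_index t) ` {t. t < \<rho> \<and> fold_word v t \<noteq> 0}
        \<subseteq> {i. i < 2 * \<rho> \<and> v i \<noteq> 0}"
    using odd_index_less by (auto simp: fold_word_def)
qed simp

lemma dual_word_dominates_Cbar_dual_word:
  assumes h: "odd h" "\<not> \<rho> dvd h"
    and v: "v \<in> dual_code (subfield_GF 3) (2 * \<rho>) (code_C (\<rho> - 1) \<rho> \<theta>)" "i < 2 * \<rho>" "v i \<noteq> 0"
  obtains c j where "c \<in> code_Cbar_dual (\<rho> - 1) \<rho> h \<beta>" "j < \<rho>" "c j \<noteq> 0"
    "hamming_weight \<rho> c \<le> hamming_weight (2 * \<rho>) v"
proof -
  note vD = v(1)[unfolded mem_dual_code_C_iff]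
  have v3: "v (2 * t) \<in> subfield_GF 3" "v (odd_index t) \<in> subfield_GF 3" if "t < \<rho>" for t
    using vD that odd_index_less by auto
  obtain t where t: "t < \<rho>" "i = 2 * t \<or> i = odd_index t"
    using index_cover[OF v(2)] .
  hence ft: "fold_word v t \<noteq> 0"
    using fold_word_eq_0[of v t] v3[OF t(1)] v(3) by auto
  \<comment> \<open>The sign turns powers of \<open>\<theta> ^ 2\<close> into powers of
    \<open>inverse \<zeta>\<close>, so vanishing at \<open>\<theta> ^ 2\<close> becomes a zero of
    the transform at -1.\<close>
  define u where "u = (\<lambda>x. let i = nat (x mod int \<rho>) in (-1) ^ i * fold_word v i)"
  have u_int: "u (int i) = (-1) ^ i * fold_word v i" if "i < \<rho>" for i
    using that by (simp add: u_def Let_def)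
  have per_u: "periodic u"
    unfolding periodic_def u_def by (simp add: cong_def)
  have u9: "u x ^ 9 = u x" for x
  proof -
    have lt: "nat (x mod int \<rho>) < \<rho>"
      using p_pos by (simp add: nat_less_iff)
    have "((-1 :: 'a) ^ i) ^ 9 = (-1) ^ i" for i
      by (cases "even i") auto
    thus ?thesis
      unfolding u_def Let_def power_mult_distrib using fold_word_power_9[OF v3[OF lt]] by simp
  qed
  have "dft u (-1) = (\<Sum>i<\<rho>. fold_word v i * \<theta> ^ (2 * i))"
    unfolding dft_def sum_Zp
  proof (intro sum.cong refl)
    fix i assume i: "i \<in> {..<\<rho>}"
    have "\<zeta> powi (-1 * int i) = inverse \<zeta> ^ i"
      by (simp only: power_int_minus power_inverse mult_minus1 power_int_of_nat)
    also have "inverse \<zeta> = - (\<theta> ^ 2)"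
      by (simp add: power_inverse)
    also have "(- (\<theta> ^ 2)) ^ i = (-1) ^ i * \<theta> ^ (2 * i)"
      by (subst power_minus) (simp only: power_mult)
    finally show "u (int i) * \<zeta> powi (-1 * int i) = fold_word v i * \<theta> ^ (2 * i)"
      using i by (simp add: u_int)
  qed
  hence dft_u: "dft u (-1) = 0"
    using vD sum_fold_word by simp
  have "\<exists>f. periodic f \<and> (\<forall>x. f x ^ 9 = f x) \<and> (\<forall>x. f x = 0 \<longleftrightarrow> u x = 0) \<and>
          (\<exists>k. dft f (- k) = 0 \<and> Legendre k (int \<rho>) = - Legendre (int h) (int \<rho>))"
  proof (cases "Legendre (int h) (int \<rho>) = -1")
    case True
    hence "Legendre 1 (int \<rho>) = - Legendre (int h) (int \<rho>)"
      using Legendre_1[OF prime_\<rho>] by simp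
    thus ?thesis
      using per_u u9 dft_u by blast
  next
    case False
    hence "Legendre (int h) (int \<rho>) = 1"
      using Legendre_cases[of "int h" "int \<rho>"] Legendre_eq_0_iff[of "int h" "int \<rho>"] h by auto
    hence "Legendre 3 (int \<rho>) = - Legendre (int h) (int \<rho>)"
      using Legendre_3 by simp
    \<comment> \<open>When \<open>h\<close> is a square, the zero at -1 belongs to the wrong class.
      Cubing keeps the support and moves the zero to -3, and 3 is a nonsquare.\<close>
    moreover have "dft (\<lambda>x. u x ^ 3) (- 3) = 0"
    proof -
      have "dft (\<lambda>x. u x ^ 3) (- 3) = dft u (-1) ^ (3 ^ 1)"
        unfolding dft_def frobenius_sum
        by (intro sum.cong refl) (simp add: power_mult_distrib power_int_power' mult.commute)
      thus ?thesis using dft_u by simp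
    qed
    moreover have "periodic (\<lambda>x. u x ^ 3)"
      using per_u unfolding periodic_def by metis
    moreover have "(u x ^ 3) ^ 9 = u x ^ 3" for x
      using u9[of x] by (metis power_mult mult.commute)
    ultimately show ?thesis
      by (intro exI[of _ "\<lambda>x. u x ^ 3"]) auto
  qed
  then obtain f k where f: "periodic f" "\<And>x. f x ^ 9 = f x" "\<And>x. f x = 0 \<longleftrightarrow> u x = 0"
    "dft f (- k) = 0" "Legendre k (int \<rho>) = - Legendre (int h) (int \<rho>)"
    by blast
  obtain a b where ab: "a ^ 9 = a" "\<And>x. f x = trace_word h a b x"
    using trace_word_exists[OF f(1,2) h(2) f(4,5)] by blast
  define c where "c = (\<lambda>i. if i < \<rho> then a * (-1) ^ i + rel_trace 9 ((\<rho> - 1) div 2) (b * \<beta> ^ (2*h*i)) else 0)"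
  have c: "c i = (-1) ^ i * f (int i)" if "i < \<rho>" for i
    using that Cbar_word_eq_trace_word[OF h(1), of a i b] by (simp add: c_def ab(2))
  have c_0: "c i = 0 \<longleftrightarrow> fold_word v i = 0" if "i < \<rho>" for i
    using that c f(3) u_int by simp
  show ?thesis
  proof (rule that[of c t])
    show "c \<in> code_Cbar_dual (\<rho> - 1) \<rho> h \<beta>"
      unfolding code_Cbar_dual_def c_def using ab(1) by (auto simp: subfield_GF_def)
    show "t < \<rho>" by fact
    show "c t \<noteq> 0" using c_0 t ft by simp
    have "{i. i < \<rho> \<and> c i \<noteq> 0} = {t. t < \<rho> \<and> fold_word v t \<noteq> 0}"
      using c_0 by auto
    thus "hamming_weight \<rho> c \<le> hamming_weight (2 * \<rho>) v"
      using fold_word_weight[of v] by (simp add: hamming_weight_def[of \<rho>])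
  qed
qed

end

section \<open>The parameters of the dual code\<close>

theorem theorem12:
  fixes \<rho> m h :: nat and \<alpha> \<beta> \<theta> :: "'a::{field,finite}"
  assumes "prime \<rho>" and "odd \<rho>"
    and "\<rho> mod 12 = 5 \<or> \<rho> mod 12 = 7"
    and "ord \<rho> 3 = \<rho> - 1"
    and "m = \<rho> - 1"
    and "card (UNIV :: 'a set) = 3 ^ m"
    and "primitive_element \<alpha>"
    and "\<beta> = \<alpha> ^ ((3 ^ m - 1) div (4 * \<rho>))"
    and "\<theta> = inverse \<beta>"
    and "odd h" and "h < 4 * \<rho>"
    and "h \<notin> {3 ^ j mod (4 * \<rho>) | j. True} \<union> {\<rho>, 3 * \<rho>}"
  shows "card (dual_code (subfield_GF 3) (2*\<rho>) (code_C m \<rho> \<theta>)) = 3 ^ (\<rho> + 1)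
       \<and> min_distance (2*\<rho>) (dual_code (subfield_GF 3) (2*\<rho>) (code_C m \<rho> \<theta>))
            \<ge> min_distance \<rho> (code_Cbar_dual m \<rho> h \<beta>)
       \<and> real (min_distance \<rho> (code_Cbar_dual m \<rho> h \<beta>)) \<ge> sqrt (real \<rho>)"
proof -
  have gt3: "\<rho> > 3"
  proof (rule ccontr)
    assume "\<not> \<rho> > 3"
    hence "\<rho> mod 12 = \<rho>" by simp
    with assms(3) \<open>\<not> \<rho> > 3\<close> show False by auto
  qed
  define N where "N = (3 ^ m - 1) div (4 * \<rho>)"
  have "[3 ^ m = 1] (mod \<rho>)"
    using ord_divides[of 3 m \<rho>] assms(4,5) by simp
  hence "\<rho> dvd 3 ^ m - 1"
    by (metis cong_altdef_nat cong_sym one_le_numeral one_le_power)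
  moreover have "4 dvd (3 :: nat) ^ m - 1"
  proof -
    have "even m" using assms(2,5) by simp
    hence "[(3 :: nat) ^ m = 1] (mod 4)"
      using ord_divides[of 3 m 4] by simp
    thus ?thesis
      by (metis cong_altdef_nat cong_sym one_le_numeral one_le_power)
  qed
  moreover have "coprime 4 \<rho>"
  proof -
    have "coprime (2 ^ 2) \<rho>" using assms(2) by (simp only: coprime_power_left_iff) simp
    thus ?thesis by simp
  qed
  ultimately have "4 * \<rho> dvd 3 ^ m - 1"
    by (intro divides_mult)
  hence N: "3 ^ m - 1 = 4 * \<rho> * N"
    unfolding N_def by simp
  have "(3 :: nat) ^ m > 1"
    using gt3 assms(5) by (intro one_less_power) auto
  hence N_pos: "N > 0"
    using N by (metis gr0I mult_0_right zero_less_diff less_irrefl)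
  have \<alpha>: "\<alpha> ^ (4 * \<rho> * N) = 1" "\<And>k. 0 < k \<Longrightarrow> \<alpha> ^ k = 1 \<Longrightarrow> 4 * \<rho> * N \<le> k"
    using primitive_element_power_eq_1[OF assms(7)] assms(6) N by auto
  have \<beta>: "\<beta> ^ k = \<alpha> ^ (N * k)" for k
    using assms(8) by (simp add: N_def power_mult)
  \<comment> \<open>As \<open>\<beta> = \<alpha> ^ N\<close> and \<open>\<alpha>\<close> has order
    \<open>4 * \<rho> * N\<close>, this power is a square root of 1 other than 1.\<close>
  have "(\<beta> ^ (2 * \<rho>)) ^ 2 = 1"
    using \<alpha>(1) by (simp add: \<beta> mult_ac flip: power_mult)
  moreover have "\<beta> ^ (2 * \<rho>) \<noteq> 1"
  proof
    assume "\<beta> ^ (2 * \<rho>) = 1"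
    hence "4 * \<rho> * N \<le> N * (2 * \<rho>)"
      using N_pos gt3 by (intro \<alpha>(2)) (auto simp: \<beta>)
    thus False using N_pos gt3 by simp
  qed
  ultimately have \<beta>1: "\<beta> ^ (2 * \<rho>) = -1"
    using power2_eq_1_iff by blast
  have \<beta>2: "\<beta> ^ 4 \<noteq> 1"
  proof
    assume "\<beta> ^ 4 = 1"
    hence "4 * \<rho> * N \<le> N * 4"
      using N_pos by (intro \<alpha>(2)) (auto simp: \<beta>)
    thus False using N_pos gt3 by simp
  qed
  have char: "CHAR('a) = 3"
  proof -
    have prime: "prime CHAR('a)"
      using finite_imp_CHAR_pos[where 'a = 'a] prime_CHAR_semidom[where 'a = 'a] by simp
    moreover have "CHAR('a) dvd 3 ^ m"
      using CHAR_dvd_CARD[where 'a = 'a] assms(6) by simp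
    ultimately have "CHAR('a) dvd 3"
      using prime_dvd_power by blast
    thus ?thesis
      using prime by (simp add: primes_dvd_imp_eq)
  qed
  interpret ternary_negacyclic \<rho> \<beta>
    by unfold_locales (use assms gt3 char \<beta>1 \<beta>2 in auto)
  \<comment> \<open>The odd multiples of \<open>\<rho>\<close> below \<open>4 * \<rho>\<close> are
    \<open>\<rho>\<close> and \<open>3 * \<rho>\<close>, both excluded.\<close>
  have h: "\<not> \<rho> dvd h"
  proof
    assume "\<rho> dvd h"
    then obtain k where k: "h = \<rho> * k" ..
    hence "k < 4" "odd k"
      using assms(10,11) by auto
    hence "k = 1 \<or> k = 3"
      by (auto simp: less_Suc_eq numeral_eq_Suc)
    with k assms(12) show False by auto
  qed
  let ?D = "dual_code (subfield_GF 3) (2*\<rho>) (code_C m \<rho> \<theta>)"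
  let ?E = "code_Cbar_dual m \<rho> h \<beta>"
  have card: "card ?D = 3 ^ (\<rho> + 1)"
    using card_dual_code_C assms(5,9) by simp
  have "min_distance \<rho> ?E \<le> min_distance (2*\<rho>) ?D"
  proof -
    \<comment> \<open>The minimum distance is a \<open>Min\<close> and needs a nonempty set of
      weights; the cardinality supplies a nonzero word.\<close>
    have "\<exists>v\<in>?D. \<exists>i<2*\<rho>. v i \<noteq> 0"
    proof (rule ccontr)
      assume none: "\<not> ?thesis"
      have "v = (\<lambda>_. 0)" if v: "v \<in> ?D" for v
      proof
        fix i show "v i = 0"
          using none v by (cases "i < 2 * \<rho>") (auto simp: dual_code_def)
      qed
      hence "?D \<subseteq> {\<lambda>_. 0}" by blast
      hence "card ?D \<le> card {\<lambda>_ :: nat. 0 :: 'a}"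
        by (intro card_mono) auto
      moreover have "(1 :: nat) < 3 ^ (\<rho> + 1)"
        by (intro one_less_power) auto
      ultimately show False
        using card by simp
    qed
    then obtain v\<^sub>0 i\<^sub>0 where v\<^sub>0: "v\<^sub>0 \<in> ?D" "i\<^sub>0 < 2*\<rho>" "v\<^sub>0 i\<^sub>0 \<noteq> 0"
      by blast
    obtain v i where v: "v \<in> ?D" "i < 2*\<rho>" "v i \<noteq> 0"
      "min_distance (2*\<rho>) ?D = hamming_weight (2*\<rho>) v"
      by (rule min_distance_attained[OF v\<^sub>0])
    have v': "v \<in> dual_code (subfield_GF 3) (2 * \<rho>) (code_C (\<rho> - 1) \<rho> (inverse \<beta>))"
      using v(1) assms(5,9) by simp
    obtain c j where "c \<in> ?E" "j < \<rho>" "c j \<noteq> 0" "hamming_weight \<rho> c \<le> hamming_weight (2*\<rho>) v"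
      unfolding assms(5) by (rule dual_word_dominates_Cbar_dual_word[OF assms(10) h v' v(2,3)])
    thus ?thesis
      using min_distance_le[of c ?E j \<rho>] v(4) by simp
  qed
  moreover have "sqrt (real \<rho>) \<le> real (min_distance \<rho> ?E)"
  proof -
    \<comment> \<open>The alternating word, with \<open>a = 1\<close> and \<open>b = 0\<close>,
      shows that the second code has a nonzero word.\<close>
    define c\<^sub>1 where "c\<^sub>1 = (\<lambda>i. if i < \<rho> then 1 * (-1) ^ i + rel_trace 9 (m div 2) (0 * \<beta> ^ (2*h*i)) else 0)"
    have "c\<^sub>1 \<in> ?E"
      unfolding code_Cbar_dual_def c\<^sub>1_def by (force simp: subfield_GF_def)
    moreover have "c\<^sub>1 0 \<noteq> 0"
      using gt3 by (simp add: c\<^sub>1_def rel_trace_def power_0_left)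
    ultimately obtain c j where c: "c \<in> ?E" "j < \<rho>" "c j \<noteq> 0"
      "min_distance \<rho> ?E = hamming_weight \<rho> c"
      using min_distance_attained[of c\<^sub>1 ?E 0 \<rho>] gt3 by auto
    hence "\<rho> \<le> (min_distance \<rho> ?E)\<^sup>2"
      using Cbar_dual_weight_bound[OF assms(10) h, of c j] assms(5) by simp
    hence "real \<rho> \<le> (real (min_distance \<rho> ?E))\<^sup>2"
      by (metis of_nat_le_iff of_nat_power)
    thus ?thesis
      by (intro real_le_lsqrt) auto
  qed
  ultimately show ?thesis
    using card by simp
qed

end
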